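(* Let $J=[Y_1,Y_2]$, where $1<Y_1<Y_2$. For almost all $y\in J$ (with respect to Lebesgue measure), $$\sum_{\substack{1\le k<\ell\le K\\ \lfloor y^k\rfloor\ne\lfloor y^\ell\rfloor}}W\bigl(\lfloor y^\ell\rfloor-\lfloor y^k\rfloor\bigr)=\left(\frac{\zeta(2)}{2\zeta(4)}+o_y(1)\right)K^2$$ as $K\to\infty$ through the positive integers.
   Context: For a nonzero integer $n$, $W(n)=\prod_{p\mid n}(1+1/p)$, the product over primes dividing $n$. $\lfloor x\rfloor$ is the greatest integer not exceeding $x$; $\zeta$ is the Riemann zeta function; $k,\ell$ are integers. $o_y(1)$ denotes a quantity tending to $0$ as $K\to\infty$ for the fixed $y$, at a rate that may depend on $y$. *)

theory Defs
  imports "HOL-Analysis.Analysis" "HOL-Computational_Algebra.Primes"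
begin

text \<open>
  The Riemann zeta function on the half-line \<open>s > 1\<close>, where the Dirichlet series converges;
  for \<open>s \<le> 1\<close> the value is meaningless (there is no analytic continuation here).
  The series is indexed from \<open>0\<close>, hence the \<open>Suc\<close>.
\<close>
definition riemann_zeta :: "real \<Rightarrow> real" where
  "riemann_zeta s = (\<Sum>n. 1 / real (Suc n) powr s)"

text \<open>
  Prime elements of \<open>int\<close> are positive by definition, so \<open>prime_factors n\<close> is the set of the usual
  primes dividing \<open>n\<close>, also for negative \<open>n\<close>.  It is empty for \<open>n = 0\<close>, where the mathematical
  function is undefined.
\<close>
definition W :: "int \<Rightarrow> real" where
  "W n = (\<Prod>p\<in>prime_factors n. 1 + 1 / real_of_int p)"

end

theory Submission imports Defs begin

text \<open>
  Write \<open>n\<^sub>k = \<lfloor>y ^ k\<rfloor>\<close>.  For a nonzero integer \<open>n\<close>, \<open>W n\<close> is the sum of \<open>1/d\<close> over the squarefree divisors \<open>d\<close>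
  of \<open>n\<close>.  If the sequence is equidistributed modulo every \<open>d\<close>, a proportion \<open>1/d\<close> of all pairs \<open>(k, l)\<close> satisfies
  \<open>d dvd n\<^sub>l - n\<^sub>k\<close>, and so the average of \<open>W\<close> should be
  \<open>\<Sum>\<^sub>d 1/d\<^sup>2 = \<Prod>\<^sub>p (1 + 1/p\<^sup>2) = \<zeta>(2)/\<zeta>(4)\<close>, the sum being over squarefree \<open>d\<close>.
  To make this rigorous one needs the equidistribution for almost all \<open>y\<close>, and a bound for the contribution of
  large divisors that holds for almost every individual \<open>y\<close>, not only on average.

  Both are consequences of one estimate.  For \<open>k < l\<close>, the set of \<open>y\<close> in an interval \<open>J\<close> with
  \<open>d dvd n\<^sub>l - n\<^sub>k\<close> has measure at most \<open>\<bar>J\<bar>/d + C r\<^sup>l\<^sup>-\<^sup>k\<close> with some \<open>r < 1\<close>, uniformly in \<open>d\<close>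
  (\<open>measure_dvd_floor_power_diff_le\<close>).  It matters that the main term has the sharp constant.  Let
  \<open>excess d n K\<close> be the number of ordered pairs up to \<open>K\<close> whose difference is divisible by \<open>d\<close>, minus \<open>K\<^sup>2/d\<close>.  The
  estimate bounds its integral over \<open>J\<close> by \<open>O(K)\<close>, uniformly in \<open>d\<close>, while the Cauchy-Schwarz inequality shows that
  the excess is nonnegative for each \<open>y\<close> (\<open>excess_nonneg\<close>).  Thus a bound for the first moment has the strength of
  a bound for the variance.  Summation over \<open>d \<le> K\<^sup>2\<close> with weights \<open>d\<^sup>-\<^sup>2\<^sup>/\<^sup>3\<close> and division
  by \<open>K\<^sup>2\<close> give a nonnegative function with integral \<open>O(K\<^sup>-\<^sup>1\<^sup>/\<^sup>3)\<close>, which is summable along the fourth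
  powers; hence it tends to \<open>0\<close> almost everywhere along them (\<open>AE_weighted_excess_tendsto_0\<close>).

  The rest concerns a fixed \<open>y\<close> (\<open>pair_sum_asymptotics\<close>).  The truncation of \<open>W\<close> to primes up to \<open>z\<close> is a
  finite combination of divisibility conditions, so its average is \<open>\<Prod>\<^sub>p\<^sub>\<le>\<^sub>z (1 + 1/p\<^sup>2) + o(1)\<close>.
  Adding the primes above \<open>z\<close> one at a time changes \<open>W n\<close> by at most \<open>3 p\<^sup>-\<^sup>2\<^sup>/\<^sup>3\<close> for each
  prime \<open>p dvd n\<close> (\<open>trunc_W_telescope\<close>).  For \<open>p \<le> K\<^sup>2\<close> the sum of these terms over all pairs is bounded by
  \<open>K\<^sup>2 \<Sum>\<^sub>d\<^sub>>\<^sub>z d\<^sup>-\<^sup>5\<^sup>/\<^sup>3\<close> and the weighted excess, and the primes above \<open>K\<^sup>2\<close> are negligible because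
  \<open>n\<^sub>l - n\<^sub>k\<close> has only \<open>O(K)\<close> prime factors.  Letting \<open>z\<close> tend to infinity yields the limit along the fourth powers, and
  the monotonicity of the sum in \<open>K\<close> yields it along all \<open>K\<close>.
\<close>

section \<open>The Euler products of \<open>\<zeta>(2)\<close> and \<open>\<zeta>(4)\<close>\<close>

text \<open>
  The sieve of Eratosthenes for the Dirichlet series: removing the multiples of a prime \<open>p\<close> from the
  index set multiplies the sum by \<open>1 - 1 / p ^ s\<close>.
\<close>
lemma has_sum_sieved_zeta:
  fixes P :: "nat set" and s :: nat
  assumes "finite P" "\<And>p. p \<in> P \<Longrightarrow> prime p" "2 \<le> s"
  shows "((\<lambda>n. 1 / real n ^ s) has_sum
           ((\<Sum>n. 1 / real (Suc n) ^ s) * (\<Prod>p\<in>P. 1 - 1 / real p ^ s)))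
         {n. 1 \<le> n \<and> (\<forall>p\<in>P. \<not> p dvd n)}"
  using assms(1,2)
proof (induction P rule: finite_induct)
  case empty
  have "summable (\<lambda>n. 1 / real (Suc n) ^ s)"
    using inverse_power_summable[OF assms(3), where 'a=real]
    by (subst summable_Suc_iff) (simp add: field_simps inverse_eq_divide)
  then have "((\<lambda>n. 1 / real (Suc n) ^ s) has_sum (\<Sum>n. 1 / real (Suc n) ^ s)) UNIV"
    by (intro norm_summable_imp_has_sum summable_sums) auto
  then have "((\<lambda>n. 1 / real n ^ s) has_sum (\<Sum>n. 1 / real (Suc n) ^ s)) (range Suc)"
    by (subst has_sum_reindex) (auto simp: o_def)
  moreover have "range Suc = {n. 1 \<le> n}"
    by (auto simp: image_iff) presburger
  ultimately show ?case by simp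
next
  case (insert p P)
  define A where "A = {n. 1 \<le> n \<and> (\<forall>q\<in>P. \<not> q dvd n)}"
  define V where "V = (\<Sum>n. 1 / real (Suc n) ^ s) * (\<Prod>q\<in>P. 1 - 1 / real q ^ s)"
  have p: "prime p" using insert by auto
  have V: "((\<lambda>n. 1 / real n ^ s) has_sum V) A"
    using insert unfolding A_def V_def by auto
  have "((\<lambda>n. 1 / real p ^ s * (1 / real n ^ s)) has_sum (1 / real p ^ s * V)) A"
    using V by (rule has_sum_cmult_right)
  then have "((\<lambda>n. 1 / real n ^ s) has_sum (1 / real p ^ s * V)) ((*) p ` A)"
    using prime_gt_0_nat[OF p] by (subst has_sum_reindex) (auto simp: o_def inj_on_def power_mult_distrib)
  moreover have "(*) p ` A \<subseteq> A"
  proof -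
    have "\<not> q dvd p * n" if "q \<in> P" "\<not> q dvd n" for q n
    proof -
      have "prime q" "q \<noteq> p" using insert that by auto
      then show ?thesis
        using that p prime_dvd_mult_iff primes_dvd_imp_eq by blast
    qed
    then show ?thesis using prime_gt_0_nat[OF p] by (auto simp: A_def)
  qed
  ultimately have "((\<lambda>n. 1 / real n ^ s) has_sum (V - 1 / real p ^ s * V)) (A - (*) p ` A)"
    using has_sum_Diff[OF V] by blast
  moreover have "A - (*) p ` A = {n. 1 \<le> n \<and> (\<forall>q\<in>insert p P. \<not> q dvd n)}"
    by (fastforce simp: A_def)
  moreover have "V - 1 / real p ^ s * V
      = (\<Sum>n. 1 / real (Suc n) ^ s) * (\<Prod>q\<in>insert p P. 1 - 1 / real q ^ s)"
    using insert by (simp add: V_def algebra_simps)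
  ultimately show ?case by simp
qed

text \<open>
  The integers that survive the sieve by all primes up to \<open>z\<close> are \<open>1\<close> and some integers above \<open>z\<close>,
  so the sieved sum tends to \<open>1\<close>.
\<close>
lemma Euler_product_tendsto:
  fixes s :: nat
  assumes "2 \<le> s"
  shows "(\<lambda>z. (\<Sum>n. 1 / real (Suc n) ^ s) * (\<Prod>p | prime p \<and> p \<le> z. 1 - 1 / real p ^ s)) \<longlonglongrightarrow> 1"
    (is "?V \<longlonglongrightarrow> 1")
proof -
  define f where "f = (\<lambda>n. 1 / real n ^ s)"
  define Z where "Z = (\<Sum>n. f (Suc n))"
  have sm: "summable (\<lambda>n. f (Suc n))"
    using inverse_power_summable[OF assms, where 'a=real] unfolding f_def
    by (subst summable_Suc_iff) (simp add: field_simps inverse_eq_divide)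
  have all: "(f has_sum Z) {n. 1 \<le> n}"
    using has_sum_sieved_zeta[of "{}" s] assms unfolding f_def Z_def by simp
  have V: "(f has_sum ?V z) {n. 1 \<le> n \<and> (\<forall>p\<in>{p. prime p \<and> p \<le> z}. \<not> p dvd n)}" for z
    unfolding f_def by (rule has_sum_sieved_zeta) (use assms in auto)
  have lower: "1 \<le> ?V z" for z
  proof (rule has_sum_mono_neutral[OF _ V])
    show "(f has_sum 1) {1}"
      using has_sum_finite[of "{1}" f] by (simp add: f_def)
  qed (auto simp: f_def prime_nat_iff)
  have upper: "?V z \<le> Z - (\<Sum>n=2..z. f n)" for z
  proof (rule has_sum_mono_neutral[OF V])
    show "(f has_sum (Z - (\<Sum>n=2..z. f n))) ({n. 1 \<le> n} - {2..z})"
      by (rule has_sum_Diff[OF all]) (auto intro!: has_sum_finite)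
    show "f n \<le> 0" if "n \<in> {n. 1 \<le> n \<and> (\<forall>p\<in>{p. prime p \<and> p \<le> z}. \<not> p dvd n)} - ({n. 1 \<le> n} - {2..z})" for n
    proof -
      have n: "2 \<le> n" "n \<le> z" using that by auto
      then obtain p where "prime p" "p dvd n" using prime_factor_nat[of n] by auto
      moreover have "p \<le> z" using dvd_imp_le[OF \<open>p dvd n\<close>] n by linarith
      ultimately show ?thesis using that by auto
    qed
  qed (auto simp: f_def)
  have "(\<lambda>N. \<Sum>n<N. f (Suc n)) \<longlonglongrightarrow> Z"
    using sm summable_LIMSEQ unfolding Z_def by blast
  then have "(\<lambda>z. 1 + Z - (\<Sum>n<z. f (Suc n))) \<longlonglongrightarrow> 1 + Z - Z"
    by (intro tendsto_intros)
  moreover have "\<forall>\<^sub>F z in sequentially. 1 + Z - (\<Sum>n<z. f (Suc n)) = Z - (\<Sum>n=2..z. f n)"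
    using eventually_ge_at_top[of 1]
  proof eventually_elim
    case (elim z)
    have "(\<Sum>n<z. f (Suc n)) = (\<Sum>n=1..z. f n)"
      by (rule sum.reindex_bij_witness[of _ "\<lambda>n. n - 1" Suc]) auto
    also have "\<dots> = f 1 + (\<Sum>n=2..z. f n)"
      using elim by (subst sum.atLeast_Suc_atMost) (auto simp: numeral_2_eq_2)
    finally show ?case by (simp add: f_def)
  qed
  ultimately have "(\<lambda>z. Z - (\<Sum>n=2..z. f n)) \<longlonglongrightarrow> 1"
    by (simp add: tendsto_cong)
  then show ?thesis
    by (rule tendsto_sandwich[OF _ _ tendsto_const, rotated 2]) (use lower upper in auto)
qed

lemma riemann_zeta_numeral:
  "riemann_zeta (numeral s) = (\<Sum>n. 1 / real (Suc n) ^ numeral s)"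
  unfolding riemann_zeta_def by (simp add: powr_numeral del: of_nat_Suc)

text \<open>
  The constant of the theorem arises as \<open>\<Prod>\<^sub>p (1 + 1/p\<^sup>2) = \<Prod>\<^sub>p (1 - 1/p\<^sup>4) / (1 - 1/p\<^sup>2)\<close>.
\<close>
lemma prod_one_plus_inverse_square_tendsto:
  "(\<lambda>z. \<Prod>p | prime p \<and> p \<le> z. 1 + 1 / real p ^ 2) \<longlonglongrightarrow> riemann_zeta 2 / riemann_zeta 4"
proof -
  define E where "E = (\<lambda>s z. \<Prod>p | prime p \<and> p \<le> (z::nat). 1 - 1 / real p ^ s)"
  have E2: "(\<lambda>z. riemann_zeta 2 * E 2 z) \<longlonglongrightarrow> 1" and E4: "(\<lambda>z. riemann_zeta 4 * E 4 z) \<longlonglongrightarrow> 1"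
    using Euler_product_tendsto[of 2] Euler_product_tendsto[of 4]
    by (simp_all only: riemann_zeta_numeral E_def)
  have nz: "riemann_zeta 4 \<noteq> 0"
    using E4 by (auto simp: LIMSEQ_const_iff)
  have nz2: "riemann_zeta 2 \<noteq> 0"
    using E2 by (auto simp: LIMSEQ_const_iff)
  have gt1: "real p > 1" if "prime p" for p :: nat
    using prime_gt_1_nat[OF that] by simp
  have E2nz: "E 2 z \<noteq> 0" for z
  proof -
    have "1 - 1 / real p ^ 2 \<noteq> 0" if "prime p" for p :: nat
      using one_less_power[OF gt1[OF that], of 2] by (simp add: field_simps)
    then show ?thesis unfolding E_def by (subst prod_zero_iff) auto
  qed
  have "E 4 z = E 2 z * (\<Prod>p | prime p \<and> p \<le> z. 1 + 1 / real p ^ 2)" for z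
    unfolding E_def prod.distrib[symmetric]
    by (intro prod.cong refl) (auto simp: algebra_simps power_divide simp flip: power_add)
  then have eq: "(\<Prod>p | prime p \<and> p \<le> z. 1 + 1 / real p ^ 2)
      = riemann_zeta 2 / riemann_zeta 4 * ((riemann_zeta 4 * E 4 z) / (riemann_zeta 2 * E 2 z))" for z
    using E2nz[of z] nz nz2 by (simp add: field_simps)
  have "(\<lambda>z. riemann_zeta 2 / riemann_zeta 4 * ((riemann_zeta 4 * E 4 z) / (riemann_zeta 2 * E 2 z)))
      \<longlonglongrightarrow> riemann_zeta 2 / riemann_zeta 4 * (1 / 1)"
    by (intro tendsto_intros E2 E4) simp
  then show ?thesis by (simp add: eq)
qed

section \<open>Truncations of \<open>W\<close>\<close>

text \<open>
  Mertens' theorem would give the order \<open>ln x\<close>, but any exponent below \<open>1/2\<close> suffices here.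
  The exponent \<open>1/3\<close> comes for free, because primes above \<open>3\<close> lie in two of the six residue
  classes modulo \<open>6\<close>.
\<close>
lemma prime_product_le:
  fixes x :: nat
  assumes "1 \<le> x"
  shows "(\<Prod>p | prime p \<and> p \<le> x. 1 + 1 / real p) \<le> 3 * real x powr (1/3)"
proof -
  define F where "F = (\<lambda>x::nat. \<Prod>p | prime p \<and> p \<le> x. 1 + 1 / real p)"
  have mono: "F x \<le> F y" if "x \<le> y" for x y
    unfolding F_def using that by (intro prod_mono2) auto
  have F_pos: "0 \<le> F x" for x unfolding F_def by (intro prod_nonneg) auto
  \<comment> \<open>A block of six integers contributes at most \<open>(1 + 1/(6k+1)) (1 + 1/(6k+5)) \<le> (1 + 1/k)\<^sup>1\<^sup>/\<^sup>3\<close>.\<close>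
  have F6: "F (6 * Suc m) ^ 3 \<le> 14 * real (Suc m)" for m
  proof (induction m)
    case 0
    have "{p::nat. prime p \<and> p \<le> 6} = {2, 3, 5}"
    proof -
      have "p \<in> {2,3,5}" if "prime p" "p \<le> 6" for p :: nat
      proof -
        have "p = 0 \<or> p = 1 \<or> p = 2 \<or> p = 3 \<or> p = 4 \<or> p = 5 \<or> p = 6" using that by arith
        moreover have "\<not> prime (4::nat)" "\<not> prime (6::nat)"
          using prime_product[of 2 2] prime_product[of 2 3] by auto
        ultimately show ?thesis using that by auto
      qed
      then show ?thesis by auto
    qed
    then show ?case by (simp add: F_def power3_eq_cube)
  next
    case (Suc m)
    define k where "k = Suc m"
    define x where "x = real k"
    have x: "x \<ge> 1" by (simp add: x_def k_def)
    define S where "S = {6 * k + 1, 6 * k + 5}"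
    have sub: "{p. prime p \<and> p \<le> 6 * Suc k} \<subseteq> {p. prime p \<and> p \<le> 6 * k} \<union> S"
    proof
      fix p assume p: "p \<in> {p. prime p \<and> p \<le> 6 * Suc k}"
      then have "\<not> 2 dvd p \<or> p \<le> 6 * k" "\<not> 3 dvd p \<or> p \<le> 6 * k"
        using primes_dvd_imp_eq[of 2 p] primes_dvd_imp_eq[of 3 p] by (auto simp: k_def)
      moreover have "p \<le> 6 * k + 6" using p by simp
      ultimately have "p \<le> 6 * k \<or> p = 6 * k + 1 \<or> p = 6 * k + 5"
        by presburger
      then show "p \<in> {p. prime p \<and> p \<le> 6 * k} \<union> S" using p by (auto simp: S_def)
    qed
    have "F (6 * Suc k) \<le> (\<Prod>p\<in>{p. prime p \<and> p \<le> 6 * k} \<union> S. 1 + 1 / real p)"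
      unfolding F_def by (rule prod_mono2) (use sub in \<open>auto simp: S_def\<close>)
    also have "\<dots> = F (6 * k) * (\<Prod>p\<in>S. 1 + 1 / real p)"
      unfolding F_def by (rule prod.union_disjoint) (auto simp: S_def)
    also have "(\<Prod>p\<in>S. 1 + 1 / real p) = (1 + 1 / (6 * x + 1)) * (1 + 1 / (6 * x + 5))"
      by (simp add: S_def x_def)
    finally have "F (6 * Suc k) ^ 3 \<le> (F (6 * k) * ((1 + 1 / (6 * x + 1)) * (1 + 1 / (6 * x + 5)))) ^ 3"
      by (intro power_mono F_pos)
    also have "\<dots> = F (6 * k) ^ 3 * ((1 + 1 / (6 * x + 1)) * (1 + 1 / (6 * x + 5))) ^ 3"
      by (rule power_mult_distrib)
    also have "\<dots> \<le> (14 * x) * ((x + 1) / x)"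
    proof (rule mult_mono)
      show "F (6 * k) ^ 3 \<le> 14 * x" using Suc.IH by (simp add: x_def k_def)
      have eq: "(1 + 1 / (6 * x + 1)) * (1 + 1 / (6 * x + 5)) = (6*x+2)*(6*x+6)/((6*x+1)*(6*x+5))"
        using x by (simp add: field_simps)
      have "x * ((6*x+2)*(6*x+6))^3 \<le> (x + 1) * ((6*x+1)*(6*x+5))^3"
      proof -
        \<comment> \<open>In terms of \<open>t = x - 1\<close> the difference is a polynomial with nonnegative coefficients.\<close>
        define t where "t = x - 1"
        have t: "t \<ge> 0" and xt: "x = t + 1" using x by (auto simp: t_def)
        have "(x + 1) * ((6*x+1)*(6*x+5))^3 - x * ((6*x+2)*(6*x+6))^3 \<ge> 0"
          unfolding xt power3_eq_cube using t by (simp add: algebra_simps)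
        then show ?thesis by simp
      qed
      then show "((1 + 1 / (6 * x + 1)) * (1 + 1 / (6 * x + 5))) ^ 3 \<le> (x + 1) / x"
        unfolding eq power_divide using x by (simp add: divide_simps mult.commute)
    qed (use x F_pos in auto)
    also have "\<dots> = 14 * (x + 1)" using x by simp
    also have "\<dots> = 14 * real (Suc (Suc m))" by (simp add: x_def k_def)
    finally show ?case by (simp add: k_def)
  qed
  have "F x \<le> F (6 * Suc (x div 6))" by (rule mono) simp
  then have "F x ^ 3 \<le> F (6 * Suc (x div 6)) ^ 3" by (intro power_mono F_pos)
  also have "\<dots> \<le> 14 * real (Suc (x div 6))" by (rule F6)
  also have "\<dots> \<le> 14 * (real x / 6 + 1)"
    using of_nat_mono[of "6 * (x div 6)" x, where 'a = real] by simp
  also have "\<dots> \<le> 27 * real x" using assms by simp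
  also have "\<dots> = (3 * real x powr (1/3)) ^ 3"
    using assms powr_power[of "real x" "1/3" 3] by (simp add: power_mult_distrib)
  finally have "F x \<le> 3 * real x powr (1/3)"
    by (rule power_le_imp_le_base[of _ 2, simplified]) simp
  then show ?thesis by (simp add: F_def)
qed

text \<open>
  \<open>trunc_W z n\<close> is the part of the product \<open>W n\<close> over the primes up to \<open>z\<close>.  Unlike \<open>W\<close>, it is defined by
  divisibility also at \<open>n = 0\<close>, so that it is a periodic function of \<open>n\<close>.
\<close>
definition trunc_W :: "nat \<Rightarrow> int \<Rightarrow> real" where
  "trunc_W z n = (\<Prod>p | prime p \<and> p \<le> z \<and> int p dvd n. 1 + 1 / real p)"

lemma trunc_W_nonneg: "0 \<le> trunc_W z n"
  unfolding trunc_W_def by (intro prod_nonneg) auto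

lemma trunc_W_le:
  assumes "1 \<le> z"
  shows "trunc_W z n \<le> 3 * real z powr (1/3)"
proof -
  have "trunc_W z n \<le> (\<Prod>p | prime p \<and> p \<le> z. 1 + 1 / real p)"
    unfolding trunc_W_def by (intro prod_mono2) auto
  then show ?thesis using prime_product_le[OF assms] by linarith
qed

lemma W_eq_trunc_W:
  assumes "n \<noteq> 0" "nat \<bar>n\<bar> \<le> x"
  shows "W n = trunc_W x n"
proof -
  have "prime_factors n = int ` {p. prime p \<and> p \<le> x \<and> int p dvd n}"
  proof (intro equalityI subsetI)
    fix q assume "q \<in> prime_factors n"
    then have q: "prime q" "q dvd n" by auto
    have "0 \<le> q" by (rule prime_ge_0_int[OF q(1)])
    moreover have "q \<le> \<bar>n\<bar>" using q(2) assms(1) by (intro zdvd_imp_le) auto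
    moreover have "prime (nat q)" using q(1) prime_int_nat_transfer by blast
    ultimately have "nat q \<in> {p. prime p \<and> p \<le> x \<and> int p dvd n}" "q = int (nat q)"
      using q(2) assms(2) by auto
    then show "q \<in> int ` {p. prime p \<and> p \<le> x \<and> int p dvd n}" by blast
  qed (use assms in \<open>auto simp: in_prime_factors_iff\<close>)
  then show ?thesis
    unfolding W_def trunc_W_def by (simp add: prod.reindex)
qed

lemma W_minus: "W (- n) = W n"
  unfolding W_def by (rule prod.cong) (auto simp: in_prime_factors_iff)

lemma trunc_W_le_W:
  assumes "n \<noteq> 0"
  shows "trunc_W z n \<le> W n"
proof -
  have "trunc_W z n \<le> trunc_W (max z (nat \<bar>n\<bar>)) n"
    unfolding trunc_W_def by (intro prod_mono2) auto
  then show ?thesis using W_eq_trunc_W[OF assms, of "max z (nat \<bar>n\<bar>)"] by simp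
qed

lemma W_nonneg: "0 \<le> W n"
  unfolding W_def
  by (intro prod_nonneg ballI add_nonneg_nonneg divide_nonneg_nonneg)
    (auto dest!: in_prime_factors_imp_prime prime_ge_0_int)

lemma trunc_W_Suc:
  "trunc_W (Suc x) n = trunc_W x n * (if prime (Suc x) \<and> int (Suc x) dvd n then 1 + 1 / real (Suc x) else 1)"
proof (cases "prime (Suc x) \<and> int (Suc x) dvd n")
  case True
  then have "{p. prime p \<and> p \<le> Suc x \<and> int p dvd n} = insert (Suc x) {p. prime p \<and> p \<le> x \<and> int p dvd n}"
    by (auto simp: le_Suc_eq)
  then show ?thesis using True by (simp add: trunc_W_def mult.commute)
next
  case False
  then have "{p. prime p \<and> p \<le> Suc x \<and> int p dvd n} = {p. prime p \<and> p \<le> x \<and> int p dvd n}"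
    by (auto simp: le_Suc_eq)
  with False show ?thesis by (auto simp: trunc_W_def)
qed

text \<open>
  Passing the prime \<open>p dvd n\<close> increases the truncated product by \<open>trunc_W (p - 1) n / p\<close>, which is at most
  \<open>3 p\<^sup>-\<^sup>2\<^sup>/\<^sup>3\<close>.  Hence only primes, rather than all squarefree divisors, occur in the estimate of
  the tail of \<open>W\<close>.
\<close>
lemma trunc_W_telescope:
  assumes "1 \<le> z" "z \<le> x"
  shows "trunc_W x n \<le> trunc_W z n
      + 3 * (\<Sum>p | prime p \<and> z < p \<and> p \<le> x \<and> int p dvd n. real p powr (-2/3))"
  using assms(2)
proof (induction x rule: dec_induct)
  case (step x)
  define D where "D = (\<lambda>x. {p. prime p \<and> z < p \<and> p \<le> x \<and> int p dvd n})"
  show ?case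
  proof (cases "prime (Suc x) \<and> int (Suc x) dvd n")
    case True
    have "trunc_W (Suc x) n = trunc_W x n + trunc_W x n / real (Suc x)"
      using True by (simp only: trunc_W_Suc if_True) (simp add: algebra_simps)
    also have "trunc_W x n / real (Suc x) \<le> 3 * real (Suc x) powr (1/3) / real (Suc x)"
    proof (rule divide_right_mono)
      have "trunc_W x n \<le> 3 * real x powr (1/3)" using step assms by (intro trunc_W_le) auto
      also have "\<dots> \<le> 3 * real (Suc x) powr (1/3)" by (intro mult_left_mono powr_mono2) auto
      finally show "trunc_W x n \<le> 3 * real (Suc x) powr (1/3)" .
    qed simp
    also have "3 * real (Suc x) powr (1/3) / real (Suc x) = 3 * real (Suc x) powr (-2/3)"
      using powr_diff[of "real (Suc x)" "1/3" 1] by (simp del: of_nat_Suc)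
    also have "trunc_W x n \<le> trunc_W z n + 3 * (\<Sum>p\<in>D x. real p powr (-2/3))"
      using step.IH by (simp add: D_def)
    finally have "trunc_W (Suc x) n \<le> trunc_W z n
        + 3 * (real (Suc x) powr (-2/3) + (\<Sum>p\<in>D x. real p powr (-2/3)))" by (simp del: of_nat_Suc)
    moreover have "D (Suc x) = insert (Suc x) (D x)"
      using True step by (auto simp: le_Suc_eq D_def)
    ultimately show ?thesis by (simp add: D_def[symmetric] del: of_nat_Suc) (simp add: D_def)
  next
    case False
    then have "D (Suc x) = D x" by (auto simp: le_Suc_eq D_def)
    then show ?thesis using step.IH False by (auto simp: trunc_W_Suc D_def)
  qed
qed (simp add: sum_nonneg)

lemma prod_primes_dvd_iff:
  fixes n :: int
  assumes "finite Q" "\<And>p. p \<in> Q \<Longrightarrow> prime p"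
  shows "int (\<Prod>Q) dvd n \<longleftrightarrow> (\<forall>p\<in>Q. int p dvd n)"
  using assms
proof (induction Q rule: finite_induct)
  case (insert p Q)
  have "coprime p (\<Prod>Q)"
    using insert by (intro prod_coprime_right) (auto intro!: primes_coprime)
  then have "coprime (int p) (int (\<Prod>Q))" by (simp only: coprime_int_iff)
  then have "int p * int (\<Prod>Q) dvd n \<longleftrightarrow> int p dvd n \<and> int (\<Prod>Q) dvd n"
    by (auto intro: divides_mult dvd_mult_left dvd_mult_right)
  then show ?case using insert by simp
qed simp

lemma prod_one_plus_expand:
  fixes f :: "'a \<Rightarrow> 'b :: comm_semiring_1"
  assumes "finite A"
  shows "(\<Prod>x\<in>A. 1 + f x) = (\<Sum>X\<in>Pow A. \<Prod>x\<in>X. f x)"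
  using prod_add[OF assms, of f "\<lambda>_. 1"] by (simp add: add.commute)

text \<open>
  The identity \<open>W n = (\<Sum>d | d dvd n \<and> squarefree d. 1 / d)\<close> in truncated form, with the
  squarefree \<open>d\<close> represented by their sets of prime factors.
\<close>
lemma trunc_W_expand:
  "trunc_W z n = (\<Sum>Q\<in>Pow {p. prime p \<and> p \<le> z}. of_bool (int (\<Prod>Q) dvd n) / real (\<Prod>Q))"
proof -
  define P where "P = {p. prime p \<and> p \<le> z}"
  have "trunc_W z n = (\<Prod>p\<in>P. 1 + of_bool (int p dvd n) / real p)"
    unfolding trunc_W_def P_def by (rule prod.mono_neutral_cong_left) auto
  also have "\<dots> = (\<Sum>Q\<in>Pow P. \<Prod>p\<in>Q. of_bool (int p dvd n) / real p)"
    by (rule prod_one_plus_expand) (simp add: P_def)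
  also have "\<dots> = (\<Sum>Q\<in>Pow P. of_bool (int (\<Prod>Q) dvd n) / real (\<Prod>Q))"
  proof (rule sum.cong[OF refl])
    fix Q assume "Q \<in> Pow P"
    then have fin: "finite Q" and pr: "\<And>p. p \<in> Q \<Longrightarrow> prime p"
      by (auto simp: P_def intro: finite_subset)
    have "(\<Prod>p\<in>Q. of_bool (int p dvd n) :: real) = of_bool (\<forall>p\<in>Q. int p dvd n)"
      using fin by (induction Q rule: finite_induct) auto
    then show "(\<Prod>p\<in>Q. of_bool (int p dvd n) / real p) = of_bool (int (\<Prod>Q) dvd n) / real (\<Prod>Q)"
      by (simp add: prod_dividef prod_primes_dvd_iff[OF fin pr] del: of_nat_prod) simp
  qed
  finally show ?thesis by (simp add: P_def)
qed

lemma prod_one_plus_inverse_square_expand: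
  "(\<Prod>p | prime p \<and> p \<le> z. 1 + 1 / real p ^ 2)
    = (\<Sum>Q\<in>Pow {p. prime p \<and> p \<le> z}. 1 / real (\<Prod>Q) ^ 2)"
  by (subst prod_one_plus_expand) (auto intro!: sum.cong simp: prod_dividef prod_power_distrib)

lemma two_power_card_prime_divisors_le:
  fixes n :: int
  assumes "n \<noteq> 0" "finite Q" "\<And>p. p \<in> Q \<Longrightarrow> prime p \<and> int p dvd n"
  shows "2 ^ card Q \<le> \<bar>n\<bar>"
proof -
  have "(2::nat) ^ card Q = (\<Prod>p\<in>Q. 2)" by simp
  also have "\<dots> \<le> \<Prod>Q" using assms by (intro prod_mono) (auto dest: prime_ge_2_nat)
  finally have "(2::int) ^ card Q \<le> int (\<Prod>Q)"
    by (metis of_nat_le_iff of_nat_numeral of_nat_power)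
  also have "\<dots> \<le> \<bar>n\<bar>"
    using assms prod_primes_dvd_iff[of Q n] by (intro zdvd_imp_le) auto
  finally show ?thesis .
qed

lemma prod_primes_ge_1:
  assumes "Q \<in> Pow {p::nat. prime p \<and> p \<le> z}"
  shows "1 \<le> \<Prod>Q"
proof -
  have "0 < p" if "p \<in> Q" for p using assms that prime_gt_0_nat[of p] by blast
  then have "0 < \<Prod>Q" by (rule prod_pos)
  then show ?thesis by simp
qed

text \<open>
  A nonzero integer of size at most \<open>B ^ K\<close> has \<open>O(K)\<close> prime factors.  Those above \<open>K\<^sup>2\<close> therefore contribute
  \<open>O(K (K\<^sup>2)\<^sup>-\<^sup>2\<^sup>/\<^sup>3)\<close> to the tail of \<open>W\<close>, which is the last summand.
\<close>
lemma W_le_trunc_W: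
  fixes n :: int and B :: real
  assumes "n \<noteq> 0" "\<bar>real_of_int n\<bar> \<le> B ^ K" "1 \<le> B" "1 \<le> K" "1 \<le> z"
  shows "W n \<le> trunc_W z n
      + 3 * (\<Sum>d=Suc z..K^2. real d powr (-2/3) * of_bool (int d dvd n))
      + 3 * log 2 B * real K powr (-1/3)"
proof -
  define x where "x = max (nat \<bar>n\<bar>) z"
  define D where "D = {p. prime p \<and> z < p \<and> p \<le> x \<and> int p dvd n}"
  define D1 where "D1 = {p\<in>D. p \<le> K^2}"
  define D2 where "D2 = {p\<in>D. K^2 < p}"
  have fin: "finite D" unfolding D_def by simp
  have "W n = trunc_W x n" by (rule W_eq_trunc_W) (use assms in \<open>auto simp: x_def\<close>)
  also have "\<dots> \<le> trunc_W z n + 3 * (\<Sum>p\<in>D. real p powr (-2/3))"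
    unfolding D_def by (rule trunc_W_telescope) (use assms in \<open>auto simp: x_def\<close>)
  also have "(\<Sum>p\<in>D. real p powr (-2/3)) = (\<Sum>p\<in>D1. real p powr (-2/3)) + (\<Sum>p\<in>D2. real p powr (-2/3))"
    by (subst sum.union_disjoint[symmetric]) (auto simp: D1_def D2_def fin intro!: sum.cong)
  also have "(\<Sum>p\<in>D1. real p powr (-2/3)) \<le> (\<Sum>d=Suc z..K^2. real d powr (-2/3) * of_bool (int d dvd n))"
  proof -
    have "(\<Sum>p\<in>D1. real p powr (-2/3)) = (\<Sum>d\<in>D1. real d powr (-2/3) * of_bool (int d dvd n))"
      by (intro sum.cong) (auto simp: D1_def D_def)
    also have "\<dots> \<le> (\<Sum>d=Suc z..K^2. real d powr (-2/3) * of_bool (int d dvd n))"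
      by (rule sum_mono2) (auto simp: D1_def D_def)
    finally show ?thesis .
  qed
  also have "(\<Sum>p\<in>D2. real p powr (-2/3)) \<le> log 2 B * real K powr (-1/3)"
  proof -
    have "2 ^ card D2 \<le> \<bar>n\<bar>"
      by (rule two_power_card_prime_divisors_le) (use assms fin in \<open>auto simp: D2_def D_def\<close>)
    then have "real_of_int (2 ^ card D2) \<le> real_of_int \<bar>n\<bar>" by (simp only: of_int_le_iff)
    then have "2 ^ card D2 \<le> B ^ K" using assms by simp
    then have "log 2 (2 ^ card D2) \<le> log 2 (B ^ K)"
      using assms by (subst log_le_cancel_iff) auto
    then have card: "real (card D2) \<le> real K * log 2 B"
      using assms by (simp add: log_nat_power)
    have "(\<Sum>p\<in>D2. real p powr (-2/3)) \<le> (\<Sum>p\<in>D2. real (K^2) powr (-2/3))"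
      using assms by (intro sum_mono powr_mono2') (auto simp: D2_def)
    also have "\<dots> = real (card D2) * real (K^2) powr (-2/3)" by simp
    also have "\<dots> \<le> real K * log 2 B * real (K^2) powr (-2/3)"
      using card by (intro mult_right_mono) auto
    also have "real (K^2) powr (-2/3) = real K powr (-4/3)"
      using powr_powr[of "real K" 2 "-2/3"] assms by (simp add: powr_numeral)
    also have "real K * log 2 B * real K powr (-4/3) = log 2 B * (real K powr 1 * real K powr (-4/3))"
      using assms by simp
    also have "real K powr 1 * real K powr (-4/3) = real K powr (-1/3)"
      by (subst powr_add[symmetric]) simp
    finally show ?thesis .
  qed
  finally show ?thesis by (simp add: algebra_simps)
qed

section \<open>The excess of congruent pairs\<close>

text \<open>
  \<open>excess d n K\<close> is the number of pairs \<open>(k, l)\<close> in \<open>{1..K}\<^sup>2\<close> with \<open>n k\<close> congruent to \<open>n l\<close> modulo \<open>d\<close>, minus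
  the number \<open>K\<^sup>2 / d\<close> expected of an equidistributed sequence.  The pairs are ordered and include the
  diagonal; for this reason the excess is nonnegative.
\<close>
definition excess :: "nat \<Rightarrow> (nat \<Rightarrow> int) \<Rightarrow> nat \<Rightarrow> real" where
  "excess d n K = (\<Sum>k=1..K. \<Sum>l=1..K. of_bool (int d dvd n k - n l) - 1 / real d)"

text \<open>
  The excesses of all moduli up to \<open>K\<^sup>2\<close>, with the weights \<open>d\<^sup>-\<^sup>2\<^sup>/\<^sup>3\<close> with which the primes enter the
  tail of \<open>W\<close>, in proportion to the number of pairs.
\<close>
definition weighted_excess :: "(nat \<Rightarrow> int) \<Rightarrow> nat \<Rightarrow> real" where
  "weighted_excess n K = (\<Sum>d=1..K^2. real d powr (-2/3) * excess d n K) / real K ^ 2"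

lemma sum_dvd_eq_excess:
  "(\<Sum>k=1..K. \<Sum>l=1..K. of_bool (int d dvd n k - n l)) = real K ^ 2 / real d + excess d n K"
  by (simp add: excess_def sum_subtractf power2_eq_square)

text \<open>
  If \<open>N a\<close> counts the \<open>k\<close> with \<open>n k\<close> in the class \<open>a\<close>, then the number of congruent pairs is \<open>\<Sum>\<^sub>a (N a)\<^sup>2\<close>, and
  the Cauchy-Schwarz inequality bounds it below by \<open>K\<^sup>2 / d\<close>.
\<close>
lemma excess_nonneg:
  assumes "1 \<le> d"
  shows "0 \<le> excess d n K"
proof -
  define N where "N = (\<lambda>a. \<Sum>k=1..K. of_bool (n k mod int d = a) :: real)"
  have "(\<Sum>k=1..K. \<Sum>l=1..K. of_bool (int d dvd n k - n l))
      = (\<Sum>k=1..K. \<Sum>l=1..K. \<Sum>a\<in>{0..<int d}. of_bool (n k mod int d = a) * of_bool (n l mod int d = a) :: real)"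
  proof (intro sum.cong refl)
    fix k l
    have "(\<Sum>a\<in>{0..<int d}. of_bool (n k mod int d = a) * of_bool (n l mod int d = a) :: real)
        = (\<Sum>a\<in>{0..<int d}. if a = n k mod int d then of_bool (n l mod int d = a) else 0)"
      by (intro sum.cong) auto
    also have "\<dots> = of_bool (n l mod int d = n k mod int d)"
      using assms by (subst sum.delta) auto
    also have "\<dots> = of_bool (int d dvd n k - n l)"
      by (simp add: mod_eq_dvd_iff eq_commute)
    finally show "of_bool (int d dvd n k - n l)
        = (\<Sum>a\<in>{0..<int d}. of_bool (n k mod int d = a) * of_bool (n l mod int d = a) :: real)" by simp
  qed
  also have "\<dots> = (\<Sum>k=1..K. \<Sum>a\<in>{0..<int d}. \<Sum>l=1..K. of_bool (n k mod int d = a) * of_bool (n l mod int d = a))"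
    by (subst sum.swap) simp
  also have "\<dots> = (\<Sum>a\<in>{0..<int d}. \<Sum>k=1..K. \<Sum>l=1..K. of_bool (n k mod int d = a) * of_bool (n l mod int d = a))"
    by (rule sum.swap)
  also have "\<dots> = (\<Sum>a\<in>{0..<int d}. N a ^ 2)"
    by (simp only: N_def power2_eq_square sum_product)
  finally have sq: "(\<Sum>k=1..K. \<Sum>l=1..K. of_bool (int d dvd n k - n l)) = (\<Sum>a\<in>{0..<int d}. N a ^ 2)" .
  have "(\<Sum>a\<in>{0..<int d}. N a) = (\<Sum>k=1..K. \<Sum>a\<in>{0..<int d}. of_bool (n k mod int d = a))"
    unfolding N_def by (rule sum.swap)
  also have "\<dots> = (\<Sum>k=1..K. 1)"
    using assms by (intro sum.cong refl) (simp add: of_bool_def)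
  finally have "real K ^ 2 = (\<Sum>a\<in>{0..<int d}. N a) ^ 2" by simp
  also have "\<dots> \<le> (\<Sum>a\<in>{0..<int d}. N a ^ 2) * real d"
    using sum_squared_le_sum_of_squares[of N "{0..<int d}"] assms by simp
  finally have "real K ^ 2 / real d \<le> (\<Sum>a\<in>{0..<int d}. N a ^ 2)"
    using assms by (simp add: field_simps)
  then show ?thesis using sq sum_dvd_eq_excess[of d n K] by linarith
qed

lemma weighted_excess_nonneg: "0 \<le> weighted_excess n K"
  unfolding weighted_excess_def by (intro divide_nonneg_nonneg sum_nonneg mult_nonneg_nonneg excess_nonneg) auto

lemma excess_le_weighted_excess:
  assumes "1 \<le> d" "d \<le> K^2"
  shows "excess d n K / real K ^ 2 \<le> real d powr (2/3) * weighted_excess n K"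
proof -
  have "real d powr (-2/3) * excess d n K \<le> (\<Sum>d=1..K^2. real d powr (-2/3) * excess d n K)"
    by (rule member_le_sum) (use assms in \<open>auto intro!: mult_nonneg_nonneg excess_nonneg\<close>)
  then have "real d powr (2/3) * (real d powr (-2/3) * excess d n K)
      \<le> real d powr (2/3) * (\<Sum>d=1..K^2. real d powr (-2/3) * excess d n K)"
    by (intro mult_left_mono) auto
  also have "real d powr (2/3) * (real d powr (-2/3) * excess d n K) = excess d n K"
    using assms by (simp add: mult.assoc[symmetric] powr_add[symmetric])
  finally show ?thesis
    by (simp add: weighted_excess_def divide_right_mono)
qed

section \<open>Two limit lemmas\<close>

text \<open>
  A squeeze theorem with bounds that become sharp only as the parameter \<open>z\<close> grows.
\<close>
lemma tendsto_squeeze_family: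
  fixes a :: "'a \<Rightarrow> 'b :: linorder_topology"
  assumes "\<And>z. z \<ge> z0 \<Longrightarrow> \<forall>\<^sub>F j in F. lo z j \<le> a j"
    and "\<And>z. z \<ge> z0 \<Longrightarrow> \<forall>\<^sub>F j in F. a j \<le> hi z j"
    and "\<And>z. z \<ge> z0 \<Longrightarrow> (lo z \<longlongrightarrow> l z) F" "\<And>z. z \<ge> z0 \<Longrightarrow> (hi z \<longlongrightarrow> h z) F"
    and "l \<longlonglongrightarrow> L" "h \<longlonglongrightarrow> L"
  shows "(a \<longlongrightarrow> L) F"
proof (rule order_tendstoI)
  fix c assume "c < L"
  then have "\<forall>\<^sub>F z in sequentially. c < l z" using assms(5) order_tendstoD(1) by blast
  then obtain z where z: "z \<ge> z0" "c < l z"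
    by (metis eventually_sequentially linear)
  then have "\<forall>\<^sub>F j in F. c < lo z j" using assms(3) order_tendstoD(1) by blast
  with assms(1)[OF z(1)] show "\<forall>\<^sub>F j in F. c < a j" by eventually_elim simp
next
  fix c assume "L < c"
  then have "\<forall>\<^sub>F z in sequentially. h z < c" using assms(6) order_tendstoD(2) by blast
  then obtain z where z: "z \<ge> z0" "h z < c"
    by (metis eventually_sequentially linear)
  then have "\<forall>\<^sub>F j in F. hi z j < c" using assms(4) order_tendstoD(2) by blast
  with assms(2)[OF z(1)] show "\<forall>\<^sub>F j in F. a j < c" by eventually_elim simp
qed

text \<open>
  A monotone function of order \<open>K\<^sup>2\<close> is controlled by its values on a sequence whose successive quotients
  tend to \<open>1\<close>.
\<close>
lemma tendsto_interpolate_fourth_powers: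
  fixes T :: "nat \<Rightarrow> real"
  assumes "mono T" "\<And>K. 0 \<le> T K" and lim: "(\<lambda>j. T (j ^ 4) / real (j ^ 4) ^ 2) \<longlonglongrightarrow> L"
  shows "(\<lambda>K. T K / real K ^ 2) \<longlonglongrightarrow> L"
proof -
  have "\<exists>j. j ^ 4 \<le> K \<and> K < (j + 1) ^ 4" for K :: nat
  proof (induction K)
    case 0
    show ?case by (intro exI[of _ 0]) simp
  next
    case (Suc K)
    then obtain j where j: "j ^ 4 \<le> K" "K < (j + 1) ^ 4" by blast
    show ?case
    proof (cases "Suc K = (j + 1) ^ 4")
      case True
      have "(j + 1) ^ 4 < (j + 1 + 1) ^ 4" by (rule power_strict_mono) auto
      with True show ?thesis by (metis order_refl)
    next
      case False
      with j have "j ^ 4 \<le> Suc K" "Suc K < (j + 1) ^ 4" by auto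
      then show ?thesis by blast
    qed
  qed
  then obtain j :: "nat \<Rightarrow> nat" where j: "\<And>K. j K ^ 4 \<le> K" "\<And>K. K < (j K + 1) ^ 4" by metis
  have j_top: "filterlim j at_top sequentially"
    unfolding filterlim_at_top
  proof
    fix N
    show "\<forall>\<^sub>F K in sequentially. N \<le> j K"
      using eventually_ge_at_top[of "N ^ 4"]
    proof eventually_elim
      case (elim K)
      then have "N ^ 4 < (j K + 1) ^ 4" using j(2)[of K] by linarith
      then have "N < j K + 1" by (rule power_less_imp_less_base) simp
      then show ?case by simp
    qed
  qed
  define b where "b = (\<lambda>j. T (j ^ 4) / real (j ^ 4) ^ 2)"
  define lo where "lo = (\<lambda>j. b j * (real j / real (j + 1)) ^ 8)"
  define hi where "hi = (\<lambda>j. b (Suc j) * (real (j + 1) / real j) ^ 8)"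
  have r: "(\<lambda>j. real j / real (j + 1)) \<longlonglongrightarrow> 1"
    using LIMSEQ_n_over_Suc_n by simp
  have r': "(\<lambda>j. real (j + 1) / real j) \<longlonglongrightarrow> 1"
    using LIMSEQ_Suc_n_over_n[where 'a=real] by simp
  have "lo \<longlonglongrightarrow> L * 1 ^ 8" unfolding lo_def b_def by (intro tendsto_intros lim r)
  then have lo: "(\<lambda>K. lo (j K)) \<longlonglongrightarrow> L" using filterlim_compose[OF _ j_top] by simp
  have "(\<lambda>j. b (Suc j)) \<longlonglongrightarrow> L" using lim unfolding b_def by (rule LIMSEQ_Suc)
  then have "hi \<longlonglongrightarrow> L * 1 ^ 8" unfolding hi_def by (intro tendsto_intros r')
  then have hi: "(\<lambda>K. hi (j K)) \<longlonglongrightarrow> L" using filterlim_compose[OF _ j_top] by simp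
  have ev: "\<forall>\<^sub>F K in sequentially. 1 \<le> j K" using j_top unfolding filterlim_at_top by blast
  show ?thesis
  proof (rule tendsto_sandwich[OF _ _ lo hi])
    show "\<forall>\<^sub>F K in sequentially. lo (j K) \<le> T K / real K ^ 2"
      using ev
    proof eventually_elim
      case (elim K)
      define i where "i = j K"
      have i: "1 \<le> i" "i ^ 4 \<le> K" "K < (i + 1) ^ 4" using elim j by (auto simp: i_def)
      have K: "1 \<le> K" using i one_le_power[of i 4] by linarith
      have "lo i = T (i ^ 4) / real (i + 1) ^ 8"
        using i by (simp add: lo_def b_def power_divide flip: power_mult)
      also have "\<dots> \<le> T K / real (i + 1) ^ 8"
        using monoD[OF assms(1) i(2)] by (intro divide_right_mono) auto
      also have "\<dots> \<le> T K / real K ^ 2"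
      proof (rule divide_left_mono)
        have "real K \<le> real (i + 1) ^ 4" using i(3) by (metis less_imp_le of_nat_le_iff of_nat_power)
        then have "real K ^ 2 \<le> (real (i + 1) ^ 4) ^ 2" by (intro power_mono) auto
        then show "real K ^ 2 \<le> real (i + 1) ^ 8" by (simp flip: power_mult)
      qed (use assms K in auto)
      finally show ?case by (simp add: i_def)
    qed
    show "\<forall>\<^sub>F K in sequentially. T K / real K ^ 2 \<le> hi (j K)"
      using ev
    proof eventually_elim
      case (elim K)
      define i where "i = j K"
      have i: "1 \<le> i" "i ^ 4 \<le> K" "K < (i + 1) ^ 4" using elim j by (auto simp: i_def)
      have K: "1 \<le> K" using i one_le_power[of i 4] by linarith
      have "T K / real K ^ 2 \<le> T ((i + 1) ^ 4) / real K ^ 2"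
        using monoD[OF assms(1), of K "(i+1)^4"] i by (intro divide_right_mono) auto
      also have "\<dots> \<le> T ((i + 1) ^ 4) / real i ^ 8"
      proof (rule divide_left_mono)
        have "real i ^ 4 \<le> real K" using i(2) by (metis of_nat_le_iff of_nat_power)
        then have "(real i ^ 4) ^ 2 \<le> real K ^ 2" by (intro power_mono) auto
        then show "real i ^ 8 \<le> real K ^ 2" by (simp flip: power_mult)
      qed (use assms K i in auto)
      also have "\<dots> = hi i"
        using i by (simp add: hi_def b_def power_divide flip: power_mult)
      finally show ?case by (simp add: i_def)
    qed
  qed
qed

section \<open>The average of \<open>W\<close> over the differences of a sequence\<close>

text \<open>
  The sum of the theorem, taken over ordered pairs \<open>(k, l)\<close> and therefore twice as large.
\<close>
definition pair_sum :: "(nat \<Rightarrow> int) \<Rightarrow> nat \<Rightarrow> real" where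
  "pair_sum n K = (\<Sum>k=1..K. \<Sum>l=1..K. if n k \<noteq> n l then W (n k - n l) else 0)"

lemma mono_pair_sum: "mono (pair_sum n)"
proof
  fix K K' :: nat assume "K \<le> K'"
  have "pair_sum n K \<le> (\<Sum>k=1..K. \<Sum>l=1..K'. if n k \<noteq> n l then W (n k - n l) else 0)"
    unfolding pair_sum_def using \<open>K \<le> K'\<close> by (intro sum_mono sum_mono2) (auto simp: W_nonneg)
  also have "\<dots> \<le> pair_sum n K'"
    unfolding pair_sum_def using \<open>K \<le> K'\<close> by (intro sum_mono2) (auto intro!: sum_nonneg simp: W_nonneg)
  finally show "pair_sum n K \<le> pair_sum n K'" .
qed

lemma pair_sum_nonneg: "0 \<le> pair_sum n K"
  unfolding pair_sum_def by (auto intro!: sum_nonneg simp: W_nonneg)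

lemma sum_pairs_eq_half_pair_sum:
  "(\<Sum>(k, l)\<in>{(k, l). 1 \<le> k \<and> k < l \<and> l \<le> K \<and> n k \<noteq> n l}. W (n l - n k)) = pair_sum n K / 2"
proof -
  define A where "A = {(k, l). 1 \<le> k \<and> k < l \<and> l \<le> K \<and> n k \<noteq> n l}"
  define A' where "A' = {(k, l). 1 \<le> l \<and> l < k \<and> k \<le> K \<and> n k \<noteq> n l}"
  define F where "F = (\<lambda>(k, l). W (n l - n k))"
  have fin: "finite A" "finite A'"
    by (rule finite_subset[of _ "{1..K} \<times> {1..K}"]; auto simp: A_def A'_def)+
  have swap: "sum F A' = sum F A"
  proof (rule sum.reindex_bij_witness[of _ prod.swap prod.swap])
    fix x assume "x \<in> A'"
    then show "F (prod.swap x) = F x"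
      using W_minus[of "n (fst x) - n (snd x)"] by (cases x) (auto simp: F_def)
  qed (auto simp: A_def A'_def)
  have "pair_sum n K = (\<Sum>(k, l)\<in>{1..K} \<times> {1..K}. if n k \<noteq> n l then W (n k - n l) else 0)"
    unfolding pair_sum_def by (rule sum.cartesian_product)
  also have "\<dots> = (\<Sum>x\<in>A \<union> A'. F x)"
  proof (rule sum.mono_neutral_cong_right)
    fix x assume "x \<in> A \<union> A'"
    then show "(case x of (k, l) \<Rightarrow> if n k \<noteq> n l then W (n k - n l) else 0) = F x"
      using W_minus[of "n (fst x) - n (snd x)"] by (cases x) (auto simp: F_def A_def A'_def)
  next
    show "\<forall>x\<in>{1..K} \<times> {1..K} - (A \<union> A'). (case x of (k, l) \<Rightarrow> if n k \<noteq> n l then W (n k - n l) else 0) = 0"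
      by (auto simp: A_def A'_def) (metis nat_neq_iff)+
  qed (auto simp: A_def A'_def)
  also have "\<dots> = sum F A + sum F A'"
    by (rule sum.union_disjoint) (use fin in \<open>auto simp: A_def A'_def\<close>)
  finally have "sum F A = pair_sum n K / 2" by (simp only: swap) simp
  then show ?thesis by (simp only: A_def F_def)
qed

lemma sum_trunc_W:
  "(\<Sum>k=1..K. \<Sum>l=1..K. trunc_W z (n k - n l))
     = (\<Prod>p | prime p \<and> p \<le> z. 1 + 1 / real p ^ 2) * real K ^ 2
       + (\<Sum>Q\<in>Pow {p. prime p \<and> p \<le> z}. excess (\<Prod>Q) n K / real (\<Prod>Q))"
proof -
  have "(\<Sum>k=1..K. \<Sum>l=1..K. trunc_W z (n k - n l))
      = (\<Sum>Q\<in>Pow {p. prime p \<and> p \<le> z}. \<Sum>k=1..K. \<Sum>l=1..K. of_bool (int (\<Prod>Q) dvd n k - n l) / real (\<Prod>Q))"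
    unfolding trunc_W_expand by (subst (2) sum.swap, subst sum.swap) simp
  also have "\<dots> = (\<Sum>Q\<in>Pow {p. prime p \<and> p \<le> z}. 1 / real (\<Prod>Q) ^ 2 * real K ^ 2 + excess (\<Prod>Q) n K / real (\<Prod>Q))"
  proof (intro sum.cong refl)
    fix Q
    have "(\<Sum>k=1..K. \<Sum>l=1..K. of_bool (int (\<Prod>Q) dvd n k - n l) / real (\<Prod>Q))
       = (real K ^ 2 / real (\<Prod>Q) + excess (\<Prod>Q) n K) / real (\<Prod>Q)"
      unfolding sum_dvd_eq_excess[symmetric] by (simp only: sum_divide_distrib)
    then show "(\<Sum>k=1..K. \<Sum>l=1..K. of_bool (int (\<Prod>Q) dvd n k - n l) / real (\<Prod>Q))
       = 1 / real (\<Prod>Q) ^ 2 * real K ^ 2 + excess (\<Prod>Q) n K / real (\<Prod>Q)"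
      by (simp only: add_divide_distrib power2_eq_square) simp
  qed
  finally show ?thesis
    by (simp only: sum.distrib sum_distrib_right[symmetric] prod_one_plus_inverse_square_expand)
qed

text \<open>
  The upper bound consists of the main term, the excesses of the finitely many moduli in the expansion of
  \<open>trunc_W z\<close>, the convergent tail \<open>\<Sum>\<^sub>d\<^sub>>\<^sub>z d\<^sup>-\<^sup>5\<^sup>/\<^sup>3\<close> that results from the expected number
  \<open>K\<^sup>2 / d\<close> of pairs divisible by \<open>d\<close>, the weighted excess, and the primes above \<open>K\<^sup>2\<close>.
\<close>
lemma pair_sum_le:
  assumes "\<And>k. 0 \<le> n k" "\<And>k. real_of_int (n k) \<le> B ^ k" "1 \<le> B" "1 \<le> K" "1 \<le> z"
  shows "pair_sum n K / real K ^ 2 \<le>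
     (\<Prod>p | prime p \<and> p \<le> z. 1 + 1 / real p ^ 2)
     + (\<Sum>Q\<in>Pow {p. prime p \<and> p \<le> z}. excess (\<Prod>Q) n K / real K ^ 2 / real (\<Prod>Q))
     + 3 * (\<Sum>i. real (i + Suc z) powr (-5/3)) + 3 * weighted_excess n K + 3 * log 2 B * real K powr (-1/3)"
proof -
  define E where "E = 3 * log 2 B * real K powr (-1/3)"
  have E: "0 \<le> E" unfolding E_def using assms by simp
  have "pair_sum n K \<le> (\<Sum>k=1..K. \<Sum>l=1..K. trunc_W z (n k - n l)
      + 3 * (\<Sum>d=Suc z..K^2. real d powr (-2/3) * of_bool (int d dvd n k - n l)) + E)"
    unfolding pair_sum_def
  proof (intro sum_mono)
    fix k l assume kl: "k \<in> {1..K}" "l \<in> {1..K}"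
    have rhs: "0 \<le> trunc_W z (n k - n l)
      + 3 * (\<Sum>d=Suc z..K^2. real d powr (-2/3) * of_bool (int d dvd n k - n l)) + E"
      by (intro add_nonneg_nonneg trunc_W_nonneg mult_nonneg_nonneg sum_nonneg E) auto
    have "real_of_int (n i) \<le> B ^ K" if "i \<in> {1..K}" for i
      using assms(2)[of i] power_increasing[of i K B] that assms(3) by auto
    from this[OF kl(1)] this[OF kl(2)] have "\<bar>real_of_int (n k - n l)\<bar> \<le> B ^ K"
      using assms(1)[of k] assms(1)[of l] by (simp add: abs_le_iff)
    then show "(if n k \<noteq> n l then W (n k - n l) else 0) \<le> trunc_W z (n k - n l)
      + 3 * (\<Sum>d=Suc z..K^2. real d powr (-2/3) * of_bool (int d dvd n k - n l)) + E"
      using W_le_trunc_W[of "n k - n l" B K z] assms rhs by (auto simp: E_def)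
  qed
  also have "\<dots> = (\<Sum>k=1..K. \<Sum>l=1..K. trunc_W z (n k - n l))
      + 3 * (\<Sum>k=1..K. \<Sum>l=1..K. \<Sum>d=Suc z..K^2. real d powr (-2/3) * of_bool (int d dvd n k - n l)) + E * real K ^ 2"
    by (simp add: sum.distrib power2_eq_square sum_distrib_left)
  also have "(\<Sum>k=1..K. \<Sum>l=1..K. \<Sum>d=Suc z..K^2. real d powr (-2/3) * of_bool (int d dvd n k - n l))
     = (\<Sum>d=Suc z..K^2. \<Sum>k=1..K. \<Sum>l=1..K. real d powr (-2/3) * of_bool (int d dvd n k - n l))"
    by (subst (2) sum.swap, subst sum.swap) simp
  also have "\<dots> = (\<Sum>d=Suc z..K^2. real d powr (-2/3) * (real K ^ 2 / real d + excess d n K))"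
    by (simp only: sum_dvd_eq_excess[symmetric] sum_distrib_left)
  also have "\<dots> = (\<Sum>d=Suc z..K^2. real d powr (-5/3) * real K ^ 2 + real d powr (-2/3) * excess d n K)"
  proof (intro sum.cong refl)
    fix d assume "d \<in> {Suc z..K^2}"
    then have "real d powr (-2/3) / real d = real d powr (-5/3)"
      using powr_diff[of "real d" "-2/3" 1] by simp
    then show "real d powr (-2/3) * (real K ^ 2 / real d + excess d n K)
        = real d powr (-5/3) * real K ^ 2 + real d powr (-2/3) * excess d n K"
      by (simp only: distrib_left) (metis times_divide_eq_left times_divide_eq_right mult.commute)
  qed
  also have "\<dots> = (\<Sum>d=Suc z..K^2. real d powr (-5/3)) * real K ^ 2 + (\<Sum>d=Suc z..K^2. real d powr (-2/3) * excess d n K)"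
    by (simp add: sum.distrib sum_distrib_right)
  also have "(\<Sum>d=Suc z..K^2. real d powr (-2/3) * excess d n K) \<le> weighted_excess n K * real K ^ 2"
  proof -
    have "(\<Sum>d=Suc z..K^2. real d powr (-2/3) * excess d n K) \<le> (\<Sum>d=1..K^2. real d powr (-2/3) * excess d n K)"
      by (rule sum_mono2) (auto intro!: mult_nonneg_nonneg excess_nonneg)
    then show ?thesis using assms by (simp add: weighted_excess_def)
  qed
  also have "(\<Sum>d=Suc z..K^2. real d powr (-5/3)) * real K ^ 2 \<le> (\<Sum>i. real (i + Suc z) powr (-5/3)) * real K ^ 2"
  proof (rule mult_right_mono)
    have "(\<Sum>d=Suc z..K^2. real d powr (-5/3)) = (\<Sum>i<K^2 - z. real (i + Suc z) powr (-5/3))"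
      by (rule sum.reindex_bij_witness[of _ "\<lambda>i. i + Suc z" "\<lambda>d. d - Suc z"]) auto
    also have "\<dots> \<le> (\<Sum>i. real (i + Suc z) powr (-5/3))"
    proof (rule sum_le_suminf)
      show "summable (\<lambda>i. real (i + Suc z) powr (-5/3))"
        using summable_iff_shift[of "\<lambda>i. real i powr (-5/3)" "Suc z"] summable_real_powr_iff[of "-5/3"] by simp
    qed auto
    finally show "(\<Sum>d=Suc z..K^2. real d powr (-5/3)) \<le> (\<Sum>i. real (i + Suc z) powr (-5/3))" .
  qed simp
  finally have *: "pair_sum n K \<le> (\<Sum>k=1..K. \<Sum>l=1..K. trunc_W z (n k - n l))
      + 3 * ((\<Sum>i. real (i + Suc z) powr (-5/3)) * real K ^ 2 + weighted_excess n K * real K ^ 2) + E * real K ^ 2"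
    by simp
  have "pair_sum n K / real K ^ 2 \<le> ((\<Sum>k=1..K. \<Sum>l=1..K. trunc_W z (n k - n l))
      + 3 * ((\<Sum>i. real (i + Suc z) powr (-5/3)) * real K ^ 2 + weighted_excess n K * real K ^ 2) + E * real K ^ 2) / real K ^ 2"
    using * by (rule divide_right_mono) simp
  also have "\<dots> = (\<Sum>k=1..K. \<Sum>l=1..K. trunc_W z (n k - n l)) / real K ^ 2
      + 3 * (\<Sum>i. real (i + Suc z) powr (-5/3)) + 3 * weighted_excess n K + E"
    using assms by (simp add: add_divide_distrib)
  also have "(\<Sum>k=1..K. \<Sum>l=1..K. trunc_W z (n k - n l)) / real K ^ 2 =
     (\<Prod>p | prime p \<and> p \<le> z. 1 + 1 / real p ^ 2)
     + (\<Sum>Q\<in>Pow {p. prime p \<and> p \<le> z}. excess (\<Prod>Q) n K / real K ^ 2 / real (\<Prod>Q))"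
    unfolding sum_trunc_W using assms
    by (simp add: add_divide_distrib sum_divide_distrib mult.commute)
  finally show ?thesis by (simp add: E_def)
qed

text \<open>
  The pairs with \<open>n k = n l\<close> are counted in the sum of \<open>trunc_W z\<close>, but not in \<open>pair_sum\<close>.
\<close>
lemma pair_sum_ge:
  assumes "1 \<le> K" "1 \<le> z"
  shows "(\<Prod>p | prime p \<and> p \<le> z. 1 + 1 / real p ^ 2)
     - 3 * real z powr (1/3) * ((\<Sum>k=1..K. \<Sum>l=1..K. of_bool (n k = n l)) / real K ^ 2) \<le> pair_sum n K / real K ^ 2"
proof -
  define c where "c = 3 * real z powr (1/3)"
  have "(\<Prod>p | prime p \<and> p \<le> z. 1 + 1 / real p ^ 2) * real K ^ 2 \<le> (\<Sum>k=1..K. \<Sum>l=1..K. trunc_W z (n k - n l))"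
  proof -
    have "0 \<le> (\<Sum>Q\<in>Pow {p. prime p \<and> p \<le> z}. excess (\<Prod>Q) n K / real (\<Prod>Q))"
      by (intro sum_nonneg divide_nonneg_nonneg excess_nonneg prod_primes_ge_1 of_nat_0_le_iff)
    then show ?thesis by (simp only: sum_trunc_W)
  qed
  also have "\<dots> \<le> (\<Sum>k=1..K. \<Sum>l=1..K. (if n k \<noteq> n l then W (n k - n l) else 0) + c * of_bool (n k = n l))"
    using trunc_W_le[OF assms(2)] trunc_W_le_W by (intro sum_mono) (auto simp: c_def)
  also have "\<dots> = pair_sum n K + c * (\<Sum>k=1..K. \<Sum>l=1..K. of_bool (n k = n l))"
    by (simp only: pair_sum_def sum.distrib sum_distrib_left)
  finally have "(\<Prod>p | prime p \<and> p \<le> z. 1 + 1 / real p ^ 2) * real K ^ 2 / real K ^ 2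
       \<le> (pair_sum n K + c * (\<Sum>k=1..K. \<Sum>l=1..K. of_bool (n k = n l))) / real K ^ 2"
    by (rule divide_right_mono) simp
  then show ?thesis using assms by (simp add: add_divide_distrib c_def)
qed

lemma sum_of_bool_eq_le:
  assumes "1 \<le> K"
  shows "(\<Sum>k=1..K. \<Sum>l=1..K. of_bool (n k = n l)) / real K ^ 2 \<le> 1 / real d + excess d n K / real K ^ 2"
proof -
  have "(\<Sum>k=1..K. \<Sum>l=1..K. of_bool (n k = n l)) \<le> (\<Sum>k=1..K. \<Sum>l=1..K. of_bool (int d dvd n k - n l) :: real)"
    by (intro sum_mono) auto
  then have "(\<Sum>k=1..K. \<Sum>l=1..K. of_bool (n k = n l)) / real K ^ 2 \<le> (real K ^ 2 / real d + excess d n K) / real K ^ 2"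
    unfolding sum_dvd_eq_excess by (rule divide_right_mono) simp
  then show ?thesis using assms by (simp add: add_divide_distrib)
qed

text \<open>
  The part of the argument that concerns a single sequence: a weighted excess that tends to \<open>0\<close> along the
  fourth powers determines the average of \<open>W\<close> over all pairs.  In the bounds for \<open>pair_sum\<close> one lets \<open>K\<close> tend
  to infinity for fixed \<open>z\<close>, and afterwards \<open>z\<close>.
\<close>
theorem pair_sum_asymptotics:
  assumes "\<And>k. 0 \<le> n k" "\<And>k. real_of_int (n k) \<le> B ^ k" "1 \<le> B"
    and G: "(\<lambda>j. weighted_excess n (j ^ 4)) \<longlonglongrightarrow> 0"
  shows "(\<lambda>K. pair_sum n K / real K ^ 2) \<longlonglongrightarrow> riemann_zeta 2 / riemann_zeta 4"
proof (rule tendsto_interpolate_fourth_powers[OF mono_pair_sum pair_sum_nonneg])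
  define P where "P = (\<lambda>z. \<Prod>p | prime p \<and> p \<le> z. 1 + 1 / real p ^ 2)"
  define R where "R = (\<lambda>z. \<Sum>i. real (i + Suc z) powr (-5/3))"
  define Z where "Z = (\<lambda>K. (\<Sum>k=1..K. \<Sum>l=1..K. of_bool (n k = n l)) / real K ^ 2)"
  have P: "P \<longlonglongrightarrow> riemann_zeta 2 / riemann_zeta 4"
    unfolding P_def by (rule prod_one_plus_inverse_square_tendsto)
  have R: "R \<longlonglongrightarrow> 0"
  proof -
    have "(\<lambda>z. \<Sum>i. real (i + z) powr (-5/3)) \<longlonglongrightarrow> 0"
      by (rule suminf_exist_split2) (simp add: summable_real_powr_iff)
    then show ?thesis unfolding R_def by (rule LIMSEQ_Suc)
  qed
  have pow_top: "filterlim (\<lambda>j::nat. j ^ 4) at_top sequentially"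
    by (rule filterlim_subseq) (auto simp: strict_mono_def power_strict_mono)
  have ge1: "\<forall>\<^sub>F j in sequentially. 1 \<le> (j::nat) ^ 4"
    using pow_top unfolding filterlim_at_top by blast
  have ex: "(\<lambda>j. excess d n (j ^ 4) / real (j ^ 4) ^ 2) \<longlonglongrightarrow> 0" if "1 \<le> d" for d
  proof (rule tendsto_sandwich[OF _ _ tendsto_const])
    show "\<forall>\<^sub>F j in sequentially. 0 \<le> excess d n (j ^ 4) / real (j ^ 4) ^ 2"
      using excess_nonneg[OF that] by (intro always_eventually) auto
    have "\<forall>\<^sub>F j in sequentially. d \<le> j ^ 4" using pow_top unfolding filterlim_at_top by blast
    then show "\<forall>\<^sub>F j in sequentially. excess d n (j ^ 4) / real (j ^ 4) ^ 2
        \<le> real d powr (2/3) * weighted_excess n (j ^ 4)"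
    proof eventually_elim
      case (elim j)
      have "j ^ 4 * 1 \<le> j ^ 4 * j ^ 4" using elim that by (intro mult_le_mono) auto
      with elim have "d \<le> (j ^ 4) ^ 2" by (simp add: power2_eq_square)
      then show ?case by (rule excess_le_weighted_excess[OF that])
    qed
    show "(\<lambda>j. real d powr (2/3) * weighted_excess n (j ^ 4)) \<longlonglongrightarrow> 0"
      using tendsto_mult_left[OF G, of "real d powr (2/3)"] by simp
  qed
  have Z: "(\<lambda>j. Z (j ^ 4)) \<longlonglongrightarrow> 0"
  proof (rule tendsto_squeeze_family[where ?z0.0 = 1 and lo = "\<lambda>_ _. 0" and l = "\<lambda>_. 0"])
    show "\<forall>\<^sub>F j in sequentially. Z (j ^ 4) \<le> 1 / real d + excess d n (j ^ 4) / real (j ^ 4) ^ 2" for d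
      using ge1 by eventually_elim (unfold Z_def, rule sum_of_bool_eq_le)
    show "(\<lambda>j. 1 / real d + excess d n (j ^ 4) / real (j ^ 4) ^ 2) \<longlonglongrightarrow> 1 / real d + 0" if "d \<ge> 1" for d
      by (intro tendsto_intros ex that)
    show "(\<lambda>d. 1 / real d + 0) \<longlonglongrightarrow> 0" using lim_1_over_n[where 'a=real] by simp
    show "\<forall>\<^sub>F j in sequentially. 0 \<le> Z (j ^ 4)" 
      unfolding Z_def by (intro always_eventually allI divide_nonneg_nonneg sum_nonneg) auto
  qed auto
  define hi where "hi = (\<lambda>z j. P z
     + (\<Sum>Q\<in>Pow {p. prime p \<and> p \<le> z}. excess (\<Prod>Q) n (j ^ 4) / real (j ^ 4) ^ 2 / real (\<Prod>Q))
     + 3 * R z + 3 * weighted_excess n (j ^ 4) + 3 * log 2 B * real (j ^ 4) powr (-1/3))"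
  define h where "h = (\<lambda>z. P z + (\<Sum>Q\<in>Pow {p. prime p \<and> p \<le> z}. 0 / real (\<Prod>Q)) + 3 * R z + 3 * 0 + 3 * log 2 B * 0)"
  show "(\<lambda>j. pair_sum n (j ^ 4) / real (j ^ 4) ^ 2) \<longlonglongrightarrow> riemann_zeta 2 / riemann_zeta 4"
  proof (rule tendsto_squeeze_family[where ?z0.0 = 1 and hi = hi and h = h
        and lo = "\<lambda>z j. P z - 3 * real z powr (1/3) * Z (j ^ 4)" and l = "\<lambda>z. P z - 3 * real z powr (1/3) * 0"])
    show "\<forall>\<^sub>F j in sequentially. P z - 3 * real z powr (1/3) * Z (j ^ 4) \<le> pair_sum n (j ^ 4) / real (j ^ 4) ^ 2"
      if "1 \<le> z" for z
      using ge1 by eventually_elim (unfold P_def Z_def, rule pair_sum_ge[OF _ that])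
    show "(\<lambda>j. P z - 3 * real z powr (1/3) * Z (j ^ 4)) \<longlonglongrightarrow> P z - 3 * real z powr (1/3) * 0" for z
      by (intro tendsto_intros Z)
    show "(\<lambda>z. P z - 3 * real z powr (1/3) * 0) \<longlonglongrightarrow> riemann_zeta 2 / riemann_zeta 4"
      using P by simp
    show "\<forall>\<^sub>F j in sequentially. pair_sum n (j ^ 4) / real (j ^ 4) ^ 2 \<le> hi z j" if "1 \<le> z" for z
      using ge1 by eventually_elim (unfold P_def R_def hi_def, rule pair_sum_le[OF assms(1-3) _ that])
    show "hi z \<longlonglongrightarrow> h z" for z
      unfolding hi_def h_def
    proof (intro tendsto_intros G)
      show "(\<lambda>j. excess (\<Prod>Q) n (j ^ 4) / real (j ^ 4) ^ 2) \<longlonglongrightarrow> 0" if "Q \<in> Pow {p. prime p \<and> p \<le> z}" for Q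
        by (rule ex[OF prod_primes_ge_1[OF that]])
      show "real (\<Prod>Q) \<noteq> 0" if "Q \<in> Pow {p. prime p \<and> p \<le> z}" for Q
        using prod_primes_ge_1[OF that] by linarith
      show "(\<lambda>j. real (j ^ 4) powr (-1/3)) \<longlonglongrightarrow> 0"
        by (rule tendsto_neg_powr[OF _ filterlim_compose[OF filterlim_real_sequentially pow_top]]) simp
    qed
    show "h \<longlonglongrightarrow> riemann_zeta 2 / riemann_zeta 4"
      unfolding h_def using tendsto_add[OF P tendsto_mult_left[OF R, of 3]] by simp
  qed
qed

section \<open>The measure of the divisibility conditions on \<open>\<lfloor>y ^ l\<rfloor> - \<lfloor>y ^ k\<rfloor>\<close>\<close>

lemma power_diff_bounds:
  fixes x y :: real
  assumes "0 \<le> x" "x \<le> y" "1 \<le> l"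
  shows "real l * x ^ (l - 1) * (y - x) \<le> y ^ l - x ^ l"
    and "y ^ l - x ^ l \<le> real l * y ^ (l - 1) * (y - x)"
proof -
  define S where "S = (\<Sum>i<l. x ^ (l - Suc i) * y ^ i)"
  have eq: "y ^ l - x ^ l = (y - x) * S"
    unfolding S_def by (rule power_diff_sumr2)
  have bnd: "x ^ (l - 1) \<le> x ^ (l - Suc i) * y ^ i" "x ^ (l - Suc i) * y ^ i \<le> y ^ (l - 1)" if "i < l" for i
  proof -
    have "l - 1 = (l - Suc i) + i" using that by simp
    then have p: "z ^ (l - 1) = z ^ (l - Suc i) * z ^ i" for z :: real by (metis power_add)
    show "x ^ (l - 1) \<le> x ^ (l - Suc i) * y ^ i" "x ^ (l - Suc i) * y ^ i \<le> y ^ (l - 1)"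
      unfolding p using assms by (auto intro!: mult_left_mono mult_right_mono power_mono)
  qed
  have "real l * x ^ (l - 1) \<le> S" "S \<le> real l * y ^ (l - 1)"
    using sum_mono[of "{..<l}" "\<lambda>_. x ^ (l - 1)" "\<lambda>i. x ^ (l - Suc i) * y ^ i"]
      sum_mono[of "{..<l}" "\<lambda>i. x ^ (l - Suc i) * y ^ i" "\<lambda>_. y ^ (l - 1)"] bnd
    by (auto simp: S_def)
  then show "real l * x ^ (l - 1) * (y - x) \<le> y ^ l - x ^ l" "y ^ l - x ^ l \<le> real l * y ^ (l - 1) * (y - x)"
    unfolding eq using assms by (auto simp: mult.commute[of "y - x"] intro!: mult_right_mono)
qed

lemma sets_floor_power_mod:
  "{y::real. \<lfloor>y ^ l\<rfloor> mod int d = a mod int d} \<in> sets borel"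
  by measurable

lemma sets_dvd_floor_power_diff:
  "{y::real. int d dvd \<lfloor>y ^ l\<rfloor> - \<lfloor>y ^ k\<rfloor>} \<in> sets borel"
  by measurable

text \<open>
  Since \<open>y ^ l\<close> is convex, the interval on which its integer part equals a given member \<open>v\<close> of the residue class
  is at most \<open>1/d\<close> times as long as the interval between the end of the previous one, where \<open>y ^ l = v - d + 1\<close>,
  and its own end.  Only the first of these intervals has no predecessor in
  \<open>[\<alpha>, \<beta>]\<close>; the derivative of \<open>y ^ l\<close> bounds its length, which is the second summand.
\<close>
lemma measure_floor_power_residue_le:
  fixes \<alpha> \<beta> :: real and d l :: nat and a :: int
  assumes "0 < \<alpha>" "\<alpha> \<le> \<beta>" "1 \<le> l" "1 \<le> d"
  shows "measure lborel ({\<alpha>..\<beta>} \<inter> {y. \<lfloor>y ^ l\<rfloor> mod int d = a mod int d})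
           \<le> (\<beta> - \<alpha>) / real d + 1 / (real l * \<alpha> ^ (l - 1))"
proof -
  \<comment> \<open>The least member of the residue class that is at least \<open>\<lfloor>\<alpha> ^ l\<rfloor>\<close>; \<open>u\<close> enumerates the class from there on.\<close>
  define b where "b = \<lfloor>\<alpha> ^ l\<rfloor> + (a - \<lfloor>\<alpha> ^ l\<rfloor>) mod int d"
  define u where "u = (\<lambda>t. real_of_int (b + int t * int d))"
  \<comment> \<open>The endpoints of the interval where the integer part of \<open>y ^ l\<close> is \<open>u t\<close>, cut off to \<open>[\<alpha>, \<beta>]\<close>.\<close>
  define s where "s = (\<lambda>t. min \<beta> (max \<alpha> (root l (u t))))"
  define e where "e = (\<lambda>t. min \<beta> (root l (u t + 1)))"
  define N where "N = Suc (nat \<lfloor>\<beta> ^ l\<rfloor>)"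
  have b_ge: "\<lfloor>\<alpha> ^ l\<rfloor> \<le> b" using assms by (simp add: b_def)
  have b_mod: "b mod int d = a mod int d" by (simp add: b_def mod_simps)
  have b_less: "b < \<lfloor>\<alpha> ^ l\<rfloor> + int d" using assms by (simp add: b_def)
  have b0: "0 \<le> b" using b_ge assms by (smt (verit) zero_le_floor zero_le_power)
  have u_ge: "real_of_int b \<le> u t" for t using assms by (simp add: u_def)
  have u0: "0 \<le> u t" for t using u_ge[of t] b0 by linarith
  have u_Suc: "u (Suc t) = u t + real d" for t by (simp add: u_def algebra_simps)
  have root_pow: "root l v ^ l = v" if "0 \<le> v" for v using assms that by simp
  have root_le: "root l v \<le> y \<longleftrightarrow> v \<le> y ^ l" if "0 \<le> y" for v y
    using assms that by (metis real_root_le_iff real_root_power_cancel Suc_le_eq One_nat_def)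
  have le_root: "y \<le> root l v \<longleftrightarrow> y ^ l \<le> v" if "0 \<le> y" for v y
    using assms that by (metis real_root_le_iff real_root_power_cancel Suc_le_eq One_nat_def)
  have \<alpha>_lt: "\<alpha> ^ l < u t + 1" for t using u_ge[of t] b_ge by linarith
  have e_ge: "\<alpha> \<le> e t" for t
    unfolding e_def using assms \<alpha>_lt[of t] by (simp add: le_root)
  have s_le_e: "s t \<le> e t" for t
  proof -
    have "root l (u t) \<le> root l (u t + 1)" using assms by simp
    then show ?thesis using e_ge[of t] assms by (simp add: s_def e_def min_le_iff_disj)
  qed
  have s_ge: "\<alpha> \<le> s t" for t using assms by (simp add: s_def)
  have cover: "{\<alpha>..\<beta>} \<inter> {y. \<lfloor>y ^ l\<rfloor> mod int d = a mod int d} \<subseteq> (\<Union>t<N. {s t..e t})"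
  proof
    fix y assume y: "y \<in> {\<alpha>..\<beta>} \<inter> {y. \<lfloor>y ^ l\<rfloor> mod int d = a mod int d}"
    then have y0: "0 \<le> y" using assms by auto
    have "\<lfloor>y ^ l\<rfloor> mod int d = b mod int d" using y b_mod by simp
    then have "int d dvd \<lfloor>y ^ l\<rfloor> - b" by (simp only: mod_eq_dvd_iff)
    then obtain q where q: "\<lfloor>y ^ l\<rfloor> - b = int d * q" by blast
    have "\<alpha> ^ l \<le> y ^ l" using y assms by (intro power_mono) auto
    then have "\<lfloor>\<alpha> ^ l\<rfloor> \<le> \<lfloor>y ^ l\<rfloor>" by (rule floor_mono)
    then have "- int d < int d * q" using q b_less by linarith
    then have "0 < int d * (q + 1)" by (simp add: distrib_left)
    then have q0: "0 \<le> q" using assms by (simp add: zero_less_mult_iff)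
    define t where "t = nat q"
    have fl: "real_of_int \<lfloor>y ^ l\<rfloor> = u t" using q q0 by (simp add: u_def t_def algebra_simps)
    have "y ^ l \<le> \<beta> ^ l" using y y0 by (intro power_mono) auto
    then have "\<lfloor>y ^ l\<rfloor> \<le> \<lfloor>\<beta> ^ l\<rfloor>" by (rule floor_mono)
    moreover have "q \<le> int d * q" using q0 assms by (simp add: mult_le_cancel_right1)
    ultimately have "q \<le> \<lfloor>\<beta> ^ l\<rfloor>" using q b0 by linarith
    then have "t < N" by (simp add: t_def N_def)
    moreover have "s t \<le> y" "y \<le> e t"
      using y y0 fl of_int_floor_le[of "y ^ l"] floor_correct[of "y ^ l"]
      by (auto simp: s_def e_def root_le le_root min_le_iff_disj)
    ultimately show "y \<in> (\<Union>t<N. {s t..e t})" by auto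
  qed
  have first: "e 0 - s 0 \<le> 1 / (real l * \<alpha> ^ (l - 1))"
  proof (cases "s 0 = \<beta>")
    case True
    then have "e 0 - s 0 \<le> 0" by (simp add: e_def)
    also have "0 \<le> 1 / (real l * \<alpha> ^ (l - 1))" using assms by simp
    finally show ?thesis .
  next
    case False
    then have "root l (u 0) \<le> s 0" using assms by (auto simp: s_def min_def)
    then have s: "u 0 \<le> s 0 ^ l" using s_ge[of 0] assms by (simp add: root_le)
    have "e 0 \<le> root l (u 0 + 1)" by (simp add: e_def)
    then have e: "e 0 ^ l \<le> u 0 + 1" using e_ge[of 0] assms by (simp add: le_root)
    have "real l * \<alpha> ^ (l - 1) * (e 0 - s 0) \<le> real l * s 0 ^ (l - 1) * (e 0 - s 0)"
      using s_le_e[of 0] s_ge[of 0] assms by (intro mult_right_mono mult_left_mono power_mono) auto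
    also have "\<dots> \<le> e 0 ^ l - s 0 ^ l"
      using s_le_e[of 0] s_ge[of 0] assms by (intro power_diff_bounds) auto
    also have "\<dots> \<le> 1" using s e by linarith
    finally show ?thesis using assms by (simp add: field_simps)
  qed
  have step: "e (Suc t) - s (Suc t) \<le> (e (Suc t) - e t) / real d" for t
  proof (cases "s (Suc t) = \<beta>")
    case True
    have "e t \<le> e (Suc t)" using assms unfolding e_def u_Suc by (intro min.mono) auto
    moreover have "e (Suc t) - s (Suc t) \<le> 0" using True by (simp add: e_def)
    ultimately show ?thesis by (smt (verit) divide_nonneg_nonneg of_nat_0_le_iff)
  next
    case False
    define S where "S = s (Suc t)"
    have "\<alpha> ^ l \<le> u (Suc t)" using \<alpha>_lt[of t] assms u_Suc[of t] by simp
    then have "\<alpha> \<le> root l (u (Suc t))" using assms by (simp add: le_root)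
    with False have S: "S = root l (u (Suc t))" "S < \<beta>" by (auto simp: S_def s_def min_def max_def split: if_splits)
    then have S_pow: "S ^ l = u (Suc t)" using u0 root_pow by simp
    have S_ge: "\<alpha> \<le> S" using s_ge by (simp add: S_def)
    have "root l (u t + 1) \<le> S" unfolding S using assms u_Suc[of t] by simp
    then have e: "e t = root l (u t + 1)" "e t \<le> S" using S by (auto simp: e_def)
    then have e_pow: "e t ^ l = u t + 1" using u0[of t] root_pow by simp
    have "e (Suc t) \<le> root l (u (Suc t) + 1)" by (simp add: e_def)
    then have e': "e (Suc t) ^ l \<le> u (Suc t) + 1" using e_ge[of "Suc t"] assms by (simp add: le_root)
    define D where "D = real l * S ^ (l - 1)"
    have D: "0 < D" using assms S_ge by (simp add: D_def)
    have "D * (e (Suc t) - S) \<le> e (Suc t) ^ l - S ^ l"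
      unfolding D_def using s_le_e[of "Suc t"] S_ge assms by (intro power_diff_bounds) (auto simp: S_def)
    then have 1: "D * (e (Suc t) - S) \<le> 1" using e' S_pow by linarith
    have "S ^ l - e t ^ l \<le> D * (S - e t)"
      unfolding D_def using e(2) e_ge[of t] assms by (intro power_diff_bounds) auto
    then have 2: "real d - 1 \<le> D * (S - e t)" using S_pow e_pow u_Suc[of t] by linarith
    have "D * ((real d - 1) * (e (Suc t) - S)) = (real d - 1) * (D * (e (Suc t) - S))" by simp
    also have "\<dots> \<le> (real d - 1) * 1" using 1 assms by (intro mult_left_mono) auto
    also have "\<dots> \<le> D * (S - e t)" using 2 by simp
    finally have "(real d - 1) * (e (Suc t) - S) \<le> S - e t" using D by simp
    then have "real d * (e (Suc t) - S) \<le> e (Suc t) - e t" by (simp add: left_diff_distrib)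
    then show ?thesis using assms by (simp add: S_def field_simps)
  qed
  have total: "(\<Sum>t<Suc n. e t - s t) \<le> 1 / (real l * \<alpha> ^ (l - 1)) + (e n - e 0) / real d" for n
  proof (induction n)
    case 0
    then show ?case using first by simp
  next
    case (Suc n)
    then show ?case using step[of n] by (simp add: diff_divide_distrib)
  qed
  have "measure lborel ({\<alpha>..\<beta>} \<inter> {y. \<lfloor>y ^ l\<rfloor> mod int d = a mod int d}) \<le> measure lborel (\<Union>t<N. {s t..e t})"
  proof (rule measure_mono_fmeasurable[OF cover])
    show "{\<alpha>..\<beta>} \<inter> {y. \<lfloor>y ^ l\<rfloor> mod int d = a mod int d} \<in> sets lborel"
      using sets_floor_power_mod by simp
    show "(\<Union>t<N. {s t..e t}) \<in> fmeasurable lborel"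
      by (intro fmeasurable.finite_UN) (auto intro!: fmeasurableI simp: emeasure_lborel_Icc_eq)
  qed
  also have "\<dots> \<le> (\<Sum>t<N. measure lborel {s t..e t})"
    by (rule measure_UNION_le) auto
  also have "\<dots> = (\<Sum>t<N. e t - s t)"
    using s_le_e by (intro sum.cong) auto
  also have "\<dots> \<le> 1 / (real l * \<alpha> ^ (l - 1)) + (e (nat \<lfloor>\<beta> ^ l\<rfloor>) - e 0) / real d"
    unfolding N_def by (rule total)
  also have "\<dots> \<le> 1 / (real l * \<alpha> ^ (l - 1)) + (\<beta> - \<alpha>) / real d"
  proof -
    have "e (nat \<lfloor>\<beta> ^ l\<rfloor>) \<le> \<beta>" by (simp add: e_def)
    then have "e (nat \<lfloor>\<beta> ^ l\<rfloor>) - e 0 \<le> \<beta> - \<alpha>" using e_ge[of 0] by linarith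
    then show ?thesis by (intro add_left_mono divide_right_mono) auto
  qed
  finally show ?thesis by simp
qed

text \<open>
  Where the integer part of \<open>y ^ k\<close> is a constant \<open>m\<close>, the condition puts the integer part of \<open>y ^ l\<close> into a fixed
  residue class.  The error terms of the previous lemma are summed over \<open>m\<close>: at \<open>x = m\<^sup>1\<^sup>/\<^sup>k\<close> the error
  \<open>1 / (l x\<^sup>l\<^sup>-\<^sup>1)\<close> is at most \<open>Y\<^sup>k\<^sup>-\<^sup>l\<close> times \<open>1 / (k x\<^sup>k\<^sup>-\<^sup>1)\<close>, which is comparable with the
  length of the interval belonging to \<open>m\<close>.
\<close>
lemma measure_dvd_floor_power_diff_le:
  fixes Y Y' :: real and d k l :: nat
  assumes "1 < Y" "Y \<le> Y'" "1 \<le> k" "k < l" "1 \<le> d"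
  shows "measure lborel ({Y..Y'} \<inter> {y. int d dvd \<lfloor>y ^ l\<rfloor> - \<lfloor>y ^ k\<rfloor>})
           \<le> (Y' - Y) / real d + (2 * (Y' - Y) + 2) * (1 / Y) ^ (l - k)"
proof -
  define x where "x = (\<lambda>m. max Y (min Y' (root k (real m))))"
  define r where "r = (1 / Y) ^ (l - k)"
  define A where "A = nat \<lfloor>Y ^ k\<rfloor>"
  define B where "B = nat \<lfloor>Y' ^ k\<rfloor>"
  define S where "S = (\<lambda>m. {x m..x (Suc m)} \<inter> {y. \<lfloor>y ^ l\<rfloor> mod int d = int m mod int d})"
  have root_pow: "root k v ^ k = v" if "0 \<le> v" for v using assms that by simp
  have root_le: "root k v \<le> y \<longleftrightarrow> v \<le> y ^ k" if "0 \<le> y" for v y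
    using assms that by (metis real_root_le_iff real_root_power_cancel Suc_le_eq One_nat_def)
  have le_root: "y \<le> root k v \<longleftrightarrow> y ^ k \<le> v" if "0 \<le> y" for v y
    using assms that by (metis real_root_le_iff real_root_power_cancel Suc_le_eq One_nat_def)
  have x_ge: "Y \<le> x m" and x_le: "x m \<le> Y'" for m using assms by (auto simp: x_def)
  have x_mono: "x m \<le> x (Suc m)" for m
    using assms unfolding x_def by (intro max.mono min.mono) auto
  have r0: "0 \<le> r" using assms by (simp add: r_def)
  have AB: "A \<le> B" unfolding A_def B_def using assms by (intro nat_mono floor_mono power_mono) auto
  have cover: "{Y..Y'} \<inter> {y. int d dvd \<lfloor>y ^ l\<rfloor> - \<lfloor>y ^ k\<rfloor>} \<subseteq> (\<Union>m\<in>{A..B}. S m)"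
  proof
    fix y assume y: "y \<in> {Y..Y'} \<inter> {y. int d dvd \<lfloor>y ^ l\<rfloor> - \<lfloor>y ^ k\<rfloor>}"
    then have y0: "0 \<le> y" using assms by auto
    define m where "m = nat \<lfloor>y ^ k\<rfloor>"
    have m: "int m = \<lfloor>y ^ k\<rfloor>" using y0 by (simp add: m_def)
    have "m \<in> {A..B}"
      unfolding m_def A_def B_def using y y0 assms by (auto intro!: nat_mono floor_mono power_mono)
    moreover have "real m \<le> y ^ k" "y ^ k \<le> real (Suc m)" using m by linarith+
    then have "x m \<le> y" "y \<le> x (Suc m)"
      using y y0 by (auto simp: x_def root_le le_root min_le_iff_disj le_max_iff_disj)
    ultimately show "y \<in> (\<Union>m\<in>{A..B}. S m)"
      using y m by (auto simp: S_def mod_eq_dvd_iff)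
  qed
  have piece: "measure lborel (S m) \<le> (x (Suc m) - x m) / real d
      + r * (2 * (x (Suc m) - x m) + of_bool (m = A) + of_bool (m = B))" if m: "m \<in> {A..B}" for m
  proof -
    have x1: "1 \<le> x m" using x_ge[of m] assms by linarith
    have "measure lborel (S m) \<le> (x (Suc m) - x m) / real d + 1 / (real l * x m ^ (l - 1))"
      unfolding S_def using assms x1 x_mono by (intro measure_floor_power_residue_le) auto
    also have "1 / (real l * x m ^ (l - 1)) \<le> r * (1 / (real k * x m ^ (k - 1)))"
    proof -
      have "l - 1 = (k - 1) + (l - k)" using assms by simp
      then have p: "x m ^ (l - 1) = x m ^ (k - 1) * x m ^ (l - k)" by (metis power_add)
      have "real k * x m ^ (k - 1) * Y ^ (l - k) \<le> real l * x m ^ (k - 1) * x m ^ (l - k)"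
        using x_ge[of m] x1 assms by (intro mult_mono power_mono) auto
      then have "1 / (real l * x m ^ (k - 1) * x m ^ (l - k)) \<le> 1 / (real k * x m ^ (k - 1) * Y ^ (l - k))"
        using assms x1 by (intro divide_left_mono) auto
      then show ?thesis unfolding p r_def by (simp add: power_divide mult_ac)
    qed
    also have "1 / (real k * x m ^ (k - 1)) \<le> 2 * (x (Suc m) - x m) + of_bool (m = A) + of_bool (m = B)"
    \<comment> \<open>The intervals of \<open>A\<close> and \<open>B\<close> may be cut off by \<open>Y\<close> and \<open>Y'\<close>, so that their length gives no bound.\<close>
    proof (cases "m = A \<or> m = B")
      case True
      have "1 * 1 \<le> real k * x m ^ (k - 1)" using assms x1 by (intro mult_mono one_le_power) auto
      then have "1 / (real k * x m ^ (k - 1)) \<le> 1" by simp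
      then show ?thesis using True x_mono[of m] by (auto simp: of_bool_def)
    next
      case False
      with m have "A < m" "m < B" by auto
      then have "Y ^ k \<le> real m" "real (Suc m) \<le> Y' ^ k"
        unfolding A_def B_def by linarith+
      then have "Y \<le> root k (real m)" "root k (real (Suc m)) \<le> Y'"
        using assms by (simp_all add: le_root root_le)
      moreover have "root k (real m) \<le> root k (real (Suc m))" using assms by simp
      ultimately have "x m = root k (real m)" "x (Suc m) = root k (real (Suc m))"
        by (simp_all add: x_def)
      then have pm: "x m ^ k = real m" and pm': "x (Suc m) ^ k = real (Suc m)"
        by (simp_all add: root_pow del: of_nat_Suc)
      have "1 \<le> m" using \<open>A < m\<close> by simp
      have k: "k = Suc (k - 1)" using assms by simp
      \<comment> \<open>As \<open>m + 1 \<le> 2 m\<close>, the derivative of \<open>y ^ k\<close> at most doubles on the interval, on which \<open>y ^ k\<close> grows by \<open>1\<close>.\<close>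
      have "x (Suc m) ^ (k - 1) * x (Suc m) = real (Suc m)" using pm' k by (metis power_Suc2)
      also have "\<dots> \<le> 2 * real m" using \<open>1 \<le> m\<close> by simp
      also have "\<dots> = 2 * (x m ^ (k - 1) * x m)" using pm k by (metis power_Suc2)
      also have "\<dots> \<le> 2 * x m ^ (k - 1) * x (Suc m)" using x_mono[of m] x1 by simp
      finally have "x (Suc m) ^ (k - 1) \<le> 2 * x m ^ (k - 1)"
        using x_ge[of "Suc m"] assms by (subst (asm) mult_le_cancel_right) auto
      then have "real k * x (Suc m) ^ (k - 1) * (x (Suc m) - x m) \<le> real k * (2 * x m ^ (k - 1)) * (x (Suc m) - x m)"
        using x_mono[of m] by (intro mult_right_mono mult_left_mono) auto
      moreover have "x (Suc m) ^ k - x m ^ k \<le> real k * x (Suc m) ^ (k - 1) * (x (Suc m) - x m)"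
        using x1 x_mono assms by (intro power_diff_bounds) auto
      moreover have "x (Suc m) ^ k - x m ^ k = 1" by (simp add: pm pm')
      ultimately have "1 \<le> real k * (2 * x m ^ (k - 1)) * (x (Suc m) - x m)" by linarith
      then have "1 \<le> 2 * (x (Suc m) - x m) * (real k * x m ^ (k - 1))" by (simp only: mult_ac)
      moreover have "0 < real k * x m ^ (k - 1)" using x1 assms by simp
      ultimately have "1 / (real k * x m ^ (k - 1)) \<le> 2 * (x (Suc m) - x m)" by (simp only: pos_divide_le_eq)
      then show ?thesis using False by simp
    qed
    finally show ?thesis using r0 by (simp add: mult_left_mono)
  qed
  have tele: "(\<Sum>m=A..B. x (Suc m) - x m) \<le> Y' - Y"
    using sum_Suc_diff[of A B x] AB x_ge[of A] x_le[of "Suc B"] by simp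
  have "measure lborel ({Y..Y'} \<inter> {y. int d dvd \<lfloor>y ^ l\<rfloor> - \<lfloor>y ^ k\<rfloor>}) \<le> measure lborel (\<Union>m\<in>{A..B}. S m)"
  proof (rule measure_mono_fmeasurable[OF cover])
    show "{Y..Y'} \<inter> {y. int d dvd \<lfloor>y ^ l\<rfloor> - \<lfloor>y ^ k\<rfloor>} \<in> sets lborel"
      using sets_dvd_floor_power_diff by simp
    show "(\<Union>m\<in>{A..B}. S m) \<in> fmeasurable lborel"
      unfolding S_def using sets_floor_power_mod
      by (intro fmeasurable.finite_UN fmeasurable_Int_fmeasurable) (auto intro!: fmeasurableI simp: emeasure_lborel_Icc_eq)
  qed
  also have "\<dots> \<le> (\<Sum>m=A..B. measure lborel (S m))"
    unfolding S_def using sets_floor_power_mod by (intro measure_UNION_le) auto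
  also have "\<dots> \<le> (\<Sum>m=A..B. (x (Suc m) - x m) / real d
      + r * (2 * (x (Suc m) - x m) + of_bool (m = A) + of_bool (m = B)))"
    by (rule sum_mono[OF piece])
  also have "\<dots> = (\<Sum>m=A..B. x (Suc m) - x m) / real d + r * (2 * (\<Sum>m=A..B. x (Suc m) - x m) + 1 + 1)"
  proof -
    have "(\<Sum>m=A..B. of_bool (m = i)) = (1::real)" if "i = A \<or> i = B" for i
      using that AB by (auto simp: of_bool_def)
    then show ?thesis
      by (simp only: sum.distrib sum_divide_distrib[symmetric] sum_distrib_left[symmetric]) simp
  qed
  also have "\<dots> \<le> (Y' - Y) / real d + r * (2 * (Y' - Y) + 1 + 1)"
    using tele r0 by (intro add_mono divide_right_mono mult_left_mono) auto
  also have "\<dots> = (Y' - Y) / real d + (2 * (Y' - Y) + 2) * r" by algebra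
  finally show ?thesis by (simp only: r_def)
qed

section \<open>The weighted excess for almost all \<open>y\<close>\<close>

lemma sum_power_nat_dist_le:
  fixes r :: real
  assumes "0 \<le> r" "r < 1"
  shows "(\<Sum>l=1..K. r ^ ((k - l) + (l - k))) \<le> 2 / (1 - r)"
proof -
  have sm: "summable (\<lambda>i. r ^ i)" using assms by (intro summable_geometric) auto
  have geo: "(\<Sum>i<n. r ^ i) \<le> 1 / (1 - r)" for n
    using sum_le_suminf[OF sm, of "{..<n}"] suminf_geometric[of r] assms by auto
  \<comment> \<open>As subtraction truncates at \<open>0\<close>, the exponent is the distance of \<open>k\<close> and \<open>l\<close>.\<close>
  have "(\<Sum>l=1..K. r ^ ((k - l) + (l - k))) \<le> (\<Sum>l\<in>{1..k} \<union> {Suc k..k + K}. r ^ ((k - l) + (l - k)))"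
    using assms by (intro sum_mono2) auto
  also have "\<dots> = (\<Sum>l=1..k. r ^ ((k - l) + (l - k))) + (\<Sum>l=Suc k..k+K. r ^ ((k - l) + (l - k)))"
    by (intro sum.union_disjoint) auto
  also have "(\<Sum>l=1..k. r ^ ((k - l) + (l - k))) = (\<Sum>i<k. r ^ i)"
    by (rule sum.reindex_bij_witness[of _ "\<lambda>i. k - i" "\<lambda>l. k - l"]) auto
  also have "(\<Sum>l=Suc k..k+K. r ^ ((k - l) + (l - k))) = (\<Sum>i\<in>{1..K}. r ^ i)"
    by (rule sum.reindex_bij_witness[of _ "\<lambda>i. k + i" "\<lambda>l. l - k"]) auto
  also have "\<dots> \<le> (\<Sum>i<Suc K. r ^ i)" using assms by (intro sum_mono2) auto
  also have "(\<Sum>i<k. r ^ i) + (\<Sum>i<Suc K. r ^ i) \<le> 1 / (1 - r) + 1 / (1 - r)"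
    by (intro add_mono geo)
  finally show ?thesis by simp
qed

lemma sum_powr_minus_two_thirds_le:
  "(\<Sum>d=1..N. real d powr (-2/3)) \<le> 3 * real N powr (1/3)"
proof (induction N)
  case (Suc N)
  define a where "a = real (Suc N) powr (1/3)"
  define b where "b = real N powr (1/3)"
  have b: "0 \<le> b" "b \<le> a" "0 < a" unfolding a_def b_def by (auto intro: powr_mono2)
  have a3: "a ^ 3 = real (Suc N)" unfolding a_def by (subst powr_power) (simp_all del: of_nat_Suc)
  have b3: "b ^ 3 = real N" unfolding b_def by (cases "N = 0") (simp_all add: powr_power)
  have w: "real (Suc N) powr (-2/3) = 1 / a ^ 2"
    unfolding a_def by (simp add: powr_power powr_minus_divide del: of_nat_Suc)
  have "1 = a ^ 3 - b ^ 3" using a3 b3 by simp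
  also have "\<dots> \<le> 3 * a ^ 2 * (a - b)" using power_diff_bounds(2)[of b a 3] b by simp
  finally have "1 / a ^ 2 \<le> 3 * (a - b)" using b by (simp add: field_simps)
  then show ?case using Suc w by (simp add: a_def b_def)
qed simp

lemma AE_tendsto_0_of_summable_integrals:
  fixes f :: "nat \<Rightarrow> 'a \<Rightarrow> real"
  assumes int: "\<And>j. integrable M (f j)" and nonneg: "\<And>j x. 0 \<le> f j x"
    and sm: "summable (\<lambda>j. integral\<^sup>L M (f j))"
  shows "AE x in M. (\<lambda>j. f j x) \<longlonglongrightarrow> 0"
proof -
  have meas [measurable]: "\<And>j. f j \<in> borel_measurable M" using int by auto
  have "(\<integral>\<^sup>+x. (\<Sum>j. ennreal (f j x)) \<partial>M) = (\<Sum>j. \<integral>\<^sup>+x. ennreal (f j x) \<partial>M)"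
    by (rule nn_integral_suminf) (use meas in auto)
  also have "\<dots> = (\<Sum>j. ennreal (integral\<^sup>L M (f j)))"
    using int nonneg by (simp add: nn_integral_eq_integral)
  finally have eq: "(\<integral>\<^sup>+x. (\<Sum>j. ennreal (f j x)) \<partial>M) = (\<Sum>j. ennreal (integral\<^sup>L M (f j)))" .
  have fin: "(\<integral>\<^sup>+x. (\<Sum>j. ennreal (f j x)) \<partial>M) \<noteq> \<infinity>"
    unfolding eq infinity_ennreal_def
    by (rule ennreal_suminf_neq_top[OF sm]) (simp add: nonneg Bochner_Integration.integral_nonneg)
  have "(\<lambda>x. \<Sum>j. ennreal (f j x)) \<in> borel_measurable M"
    by (intro borel_measurable_suminf_order measurable_compose[OF meas measurable_ennreal])
  then have "AE x in M. (\<Sum>j. ennreal (f j x)) \<noteq> \<infinity>"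
    using fin by (rule nn_integral_noteq_infinite)
  then show ?thesis
  proof eventually_elim
    case (elim x)
    have "summable (\<lambda>j. f j x)"
      by (rule summable_suminf_not_top) (use elim nonneg in simp_all)
    then show ?case by (rule summable_LIMSEQ_zero)
  qed
qed

text \<open>
  The expected number \<open>K\<^sup>2 / d\<close> cancels exactly, and the geometric series over \<open>\<bar>k - l\<bar>\<close> leaves a bound that
  is linear in \<open>K\<close> and uniform in \<open>d\<close>.
\<close>
lemma excess_floor_power_integral:
  fixes Y Y' :: real
  assumes "1 < Y" "Y \<le> Y'" "1 \<le> d"
  defines "M \<equiv> restrict_space lborel {Y..Y'}"
  shows "integrable M (\<lambda>y. excess d (\<lambda>k. \<lfloor>y ^ k\<rfloor>) K)"
    and "integral\<^sup>L M (\<lambda>y. excess d (\<lambda>k. \<lfloor>y ^ k\<rfloor>) K) \<le> (2 * (Y' - Y) + 2) * (2 / (1 - 1 / Y)) * real K"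
proof -
  define E where "E = (\<lambda>k l. {y::real. int d dvd \<lfloor>y ^ k\<rfloor> - \<lfloor>y ^ l\<rfloor>})"
  define c where "c = 2 * (Y' - Y) + 2"
  define r where "r = 1 / Y"
  have r: "0 \<le> r" "r < 1" using assms by (auto simp: r_def)
  have E_sets: "E k l \<in> sets borel" for k l
    unfolding E_def by (rule sets_dvd_floor_power_diff)
  have fin: "finite_measure M"
    unfolding M_def using assms
    by (intro finite_measureI) (simp add: emeasure_restrict_space space_restrict_space)
  interpret finite_measure M by (rule fin)
  have space: "space M = {Y..Y'}" by (simp add: M_def space_restrict_space)
  have meas_UNIV: "measure M {Y..Y'} = Y' - Y"
    using assms by (simp add: M_def measure_restrict_space)
  have excess_eq: "excess d (\<lambda>k. \<lfloor>y ^ k\<rfloor>) K = (\<Sum>k=1..K. \<Sum>l=1..K. indicator (E k l) y - 1 / real d)" for y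
    unfolding excess_def E_def by (simp add: indicator_def of_bool_def)
  have int: "integrable M (\<lambda>y. indicator (E k l) y :: real)" for k l
  proof (rule integrable_const_bound[where B = 1])
    show "(\<lambda>y. indicator (E k l) y :: real) \<in> borel_measurable M"
      unfolding M_def using E_sets by (intro measurable_restrict_space1) auto
  qed auto
  show "integrable M (\<lambda>y. excess d (\<lambda>k. \<lfloor>y ^ k\<rfloor>) K)"
    unfolding excess_eq by (intro Bochner_Integration.integrable_sum Bochner_Integration.integrable_diff int) auto
  have val: "integral\<^sup>L M (\<lambda>y. indicator (E k l) y - 1 / real d)
      = measure lborel ({Y..Y'} \<inter> E k l) - (Y' - Y) / real d" for k l
  proof -
    have "integral\<^sup>L M (\<lambda>y. indicator (E k l) y :: real) = measure M ({Y..Y'} \<inter> E k l)"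
      by (simp add: space Int_commute)
    also have "\<dots> = measure lborel ({Y..Y'} \<inter> E k l)"
      unfolding M_def by (rule measure_restrict_space) auto
    finally show ?thesis
      using int[of k l] meas_UNIV by (simp add: space)
  qed
  \<comment> \<open>On the diagonal the set is all of the interval, whose length is at most \<open>c\<close>.\<close>
  have bound: "measure lborel ({Y..Y'} \<inter> E k l) - (Y' - Y) / real d \<le> c * r ^ ((k - l) + (l - k))"
    if "1 \<le> k" "1 \<le> l" for k l
  proof (cases k l rule: linorder_cases)
    case less
    have "E k l = {y. int d dvd \<lfloor>y ^ l\<rfloor> - \<lfloor>y ^ k\<rfloor>}" by (auto simp: E_def dvd_diff_commute)
    then show ?thesis
      using measure_dvd_floor_power_diff_le[of Y Y' k l d] assms that less by (simp add: c_def r_def)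
  next
    case greater
    then show ?thesis
      using measure_dvd_floor_power_diff_le[of Y Y' l k d] assms that by (simp add: c_def r_def E_def)
  next
    case equal
    then have "E k l = UNIV" by (simp add: E_def)
    then show ?thesis using assms equal by (simp add: c_def) (smt (verit) divide_nonneg_nonneg of_nat_0_le_iff)
  qed
  have "integral\<^sup>L M (\<lambda>y. excess d (\<lambda>k. \<lfloor>y ^ k\<rfloor>) K)
      = (\<Sum>k=1..K. \<Sum>l=1..K. integral\<^sup>L M (\<lambda>y. indicator (E k l) y - 1 / real d))"
    unfolding excess_eq by (subst Bochner_Integration.integral_sum; (intro sum.cong refl Bochner_Integration.integral_sum
        Bochner_Integration.integrable_sum Bochner_Integration.integrable_diff int)?) auto
  also have "\<dots> \<le> (\<Sum>k=1..K. \<Sum>l=1..K. c * r ^ ((k - l) + (l - k)))"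
    unfolding val by (intro sum_mono bound) auto
  also have "\<dots> \<le> (\<Sum>k=1..K. c * (2 / (1 - r)))"
    unfolding sum_distrib_left[symmetric] using assms r
    by (intro sum_mono mult_left_mono sum_power_nat_dist_le) (auto simp: c_def)
  finally show "integral\<^sup>L M (\<lambda>y. excess d (\<lambda>k. \<lfloor>y ^ k\<rfloor>) K) \<le> (2 * (Y' - Y) + 2) * (2 / (1 - 1 / Y)) * real K"
    by (simp add: c_def r_def mult_ac)
qed

text \<open>
  The integral of the weighted excess is \<open>O(K\<^sup>-\<^sup>1\<^sup>/\<^sup>3)\<close>, which is summable along \<open>K = j\<^sup>4\<close>.
\<close>
lemma AE_weighted_excess_tendsto_0:
  fixes Y Y' :: real
  assumes "1 < Y" "Y \<le> Y'"
  shows "AE y in restrict_space lborel {Y..Y'}. (\<lambda>j. weighted_excess (\<lambda>k. \<lfloor>y ^ k\<rfloor>) (j ^ 4)) \<longlonglongrightarrow> 0"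
proof (rule AE_tendsto_0_of_summable_integrals)
  define M where "M = restrict_space lborel {Y..Y'}"
  define C where "C = (2 * (Y' - Y) + 2) * (2 / (1 - 1 / Y))"
  have C: "0 \<le> C" using assms by (simp add: C_def)
  have int: "integrable M (\<lambda>y. excess d (\<lambda>k. \<lfloor>y ^ k\<rfloor>) K)" if "d \<in> {1..K^2}" for d K
    unfolding M_def using assms that by (intro excess_floor_power_integral) auto
  have int_weighted: "integrable M (\<lambda>y. weighted_excess (\<lambda>k. \<lfloor>y ^ k\<rfloor>) K)" for K
    unfolding weighted_excess_def by (intro integrable_divide_zero Bochner_Integration.integrable_sum integrable_mult_right int) auto
  then show "integrable (restrict_space lborel {Y..Y'}) (\<lambda>y. weighted_excess (\<lambda>k. \<lfloor>y ^ k\<rfloor>) (j ^ 4))" for j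
    by (simp add: M_def)
  show "0 \<le> weighted_excess (\<lambda>k. \<lfloor>y ^ k\<rfloor>) (j ^ 4)" for y :: real and j
    by (rule weighted_excess_nonneg)
  have bound: "integral\<^sup>L M (\<lambda>y. weighted_excess (\<lambda>k. \<lfloor>y ^ k\<rfloor>) K) \<le> 3 * C * real K powr (-1/3)" if K: "1 \<le> K" for K
  proof -
    have "integral\<^sup>L M (\<lambda>y. weighted_excess (\<lambda>k. \<lfloor>y ^ k\<rfloor>) K)
        = (\<Sum>d=1..K^2. real d powr (-2/3) * integral\<^sup>L M (\<lambda>y. excess d (\<lambda>k. \<lfloor>y ^ k\<rfloor>) K)) / real K ^ 2"
      unfolding weighted_excess_def using int by (simp add: Bochner_Integration.integral_sum)
    also have "\<dots> \<le> (\<Sum>d=1..K^2. real d powr (-2/3) * (C * real K)) / real K ^ 2"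
      unfolding M_def C_def using assms
      by (intro divide_right_mono sum_mono mult_left_mono excess_floor_power_integral) auto
    also have "\<dots> = C * (\<Sum>d=1..K^2. real d powr (-2/3)) / real K"
      using K by (simp add: sum_distrib_right[symmetric] power2_eq_square)
    also have "\<dots> \<le> C * (3 * real (K^2) powr (1/3)) / real K"
      using C by (intro divide_right_mono mult_left_mono sum_powr_minus_two_thirds_le) auto
    also have "real (K^2) powr (1/3) = real K powr (2/3)"
      using powr_powr[of "real K" 2 "1/3"] K by (simp add: powr_numeral)
    also have "C * (3 * real K powr (2/3)) / real K = 3 * C * (real K powr (2/3) / real K powr 1)"
      using K by simp
    also have "real K powr (2/3) / real K powr 1 = real K powr (-1/3)"
      by (subst powr_diff[symmetric]) simp
    finally show ?thesis .
  qed
  have "summable (\<lambda>j. integral\<^sup>L M (\<lambda>y. weighted_excess (\<lambda>k. \<lfloor>y ^ k\<rfloor>) (j ^ 4)))"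
  proof (rule summable_comparison_test_ev)
    show "\<forall>\<^sub>F j in sequentially. norm (integral\<^sup>L M (\<lambda>y. weighted_excess (\<lambda>k. \<lfloor>y ^ k\<rfloor>) (j ^ 4)))
        \<le> 3 * C * real j powr (-4/3)"
      using eventually_ge_at_top[of 1]
    proof eventually_elim
      case (elim j)
      have "integral\<^sup>L M (\<lambda>y. weighted_excess (\<lambda>k. \<lfloor>y ^ k\<rfloor>) (j ^ 4)) \<le> 3 * C * real (j ^ 4) powr (-1/3)"
        using elim by (intro bound) simp
      also have "real (j ^ 4) powr (-1/3) = real j powr (-4/3)"
        using powr_powr[of "real j" 4 "-1/3"] elim by (simp add: powr_numeral)
      finally show ?case
        using Bochner_Integration.integral_nonneg[of M "\<lambda>y. weighted_excess (\<lambda>k. \<lfloor>y ^ k\<rfloor>) (j ^ 4)"]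
          weighted_excess_nonneg by simp
    qed
    show "summable (\<lambda>j. 3 * C * real j powr (-4/3))"
      by (intro summable_mult) (simp add: summable_real_powr_iff)
  qed
  then show "summable (\<lambda>j. integral\<^sup>L (restrict_space lborel {Y..Y'}) (\<lambda>y. weighted_excess (\<lambda>k. \<lfloor>y ^ k\<rfloor>) (j ^ 4)))"
    by (simp add: M_def)
qed

section \<open>The asymptotic formula\<close>

theorem proposition3p6:
  fixes Y\<^sub>1 Y\<^sub>2 :: real
  assumes "1 < Y\<^sub>1" and "Y\<^sub>1 < Y\<^sub>2"
  shows "AE y in lebesgue. y \<in> {Y\<^sub>1..Y\<^sub>2} \<longrightarrow>
    (\<exists>\<epsilon> :: nat \<Rightarrow> real. \<epsilon> \<longlonglongrightarrow> 0 \<and>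
      (\<forall>K\<ge>1. (\<Sum>(k, l)\<in>{(k, l). 1 \<le> k \<and> k < l \<and> l \<le> K \<and> \<lfloor>y ^ k\<rfloor> \<noteq> \<lfloor>y ^ l\<rfloor>}.
                 W (\<lfloor>y ^ l\<rfloor> - \<lfloor>y ^ k\<rfloor>))
             = (riemann_zeta 2 / (2 * riemann_zeta 4) + \<epsilon> K) * (real K)\<^sup>2))"
proof -
  have "AE y in lborel. y \<in> {Y\<^sub>1..Y\<^sub>2} \<longrightarrow> (\<lambda>j. weighted_excess (\<lambda>k. \<lfloor>y ^ k\<rfloor>) (j ^ 4)) \<longlonglongrightarrow> 0"
    using AE_weighted_excess_tendsto_0[of Y\<^sub>1 Y\<^sub>2] assms by (simp add: AE_restrict_space_iff)
  then have "AE y in lebesgue. y \<in> {Y\<^sub>1..Y\<^sub>2} \<longrightarrow> (\<lambda>j. weighted_excess (\<lambda>k. \<lfloor>y ^ k\<rfloor>) (j ^ 4)) \<longlonglongrightarrow> 0"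
    by (rule AE_completion)
  then show ?thesis
  proof eventually_elim
    case (elim y)
    show ?case
    proof
      assume y: "y \<in> {Y\<^sub>1..Y\<^sub>2}"
      define n where "n = (\<lambda>k::nat. \<lfloor>y ^ k\<rfloor>)"
      have lim: "(\<lambda>K. pair_sum n K / real K ^ 2) \<longlonglongrightarrow> riemann_zeta 2 / riemann_zeta 4"
      proof (rule pair_sum_asymptotics)
        show "0 \<le> n k" for k using y assms by (simp add: n_def)
        show "real_of_int (n k) \<le> y ^ k" for k by (simp add: n_def)
        show "1 \<le> y" using y assms by simp
        show "(\<lambda>j. weighted_excess n (j ^ 4)) \<longlonglongrightarrow> 0" using elim y by (simp add: n_def)
      qed
      define \<epsilon> where "\<epsilon> = (\<lambda>K. pair_sum n K / real K ^ 2 / 2 - riemann_zeta 2 / riemann_zeta 4 / 2)"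
      have "\<epsilon> \<longlonglongrightarrow> riemann_zeta 2 / riemann_zeta 4 / 2 - riemann_zeta 2 / riemann_zeta 4 / 2"
        unfolding \<epsilon>_def by (intro tendsto_intros lim) simp
      then have "\<epsilon> \<longlonglongrightarrow> 0" by simp
      moreover have "(\<Sum>(k, l)\<in>{(k, l). 1 \<le> k \<and> k < l \<and> l \<le> K \<and> n k \<noteq> n l}. W (n l - n k))
          = (riemann_zeta 2 / (2 * riemann_zeta 4) + \<epsilon> K) * (real K)\<^sup>2" if "K \<ge> 1" for K
        unfolding sum_pairs_eq_half_pair_sum using that by (simp add: \<epsilon>_def)
      ultimately show "\<exists>\<epsilon> :: nat \<Rightarrow> real. \<epsilon> \<longlonglongrightarrow> 0 \<and>
        (\<forall>K\<ge>1. (\<Sum>(k, l)\<in>{(k, l). 1 \<le> k \<and> k < l \<and> l \<le> K \<and> \<lfloor>y ^ k\<rfloor> \<noteq> \<lfloor>y ^ l\<rfloor>}.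
                 W (\<lfloor>y ^ l\<rfloor> - \<lfloor>y ^ k\<rfloor>))
             = (riemann_zeta 2 / (2 * riemann_zeta 4) + \<epsilon> K) * (real K)\<^sup>2)"
        unfolding n_def by blast
    qed
  qed
qed

end
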